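(* There exist bounded open sets $V_\varepsilon\subset\mathbb{R}\times\mathbb{R}$ (nonempty), $\varepsilon>0$, such that $$\frac{\|\mathbf{H}\chi_{V_\varepsilon}-\chi_{V_\varepsilon}\|_{L^2(\mathbb{R}^2)}}{\|\chi_{V_\varepsilon}\|_{L^2(\mathbb{R}^2)}}\longrightarrow 0\qquad\text{as }\varepsilon\to 0 .$$
   Context: $\chi_V$ is the indicator function of $V$. The double Hilbert transform is $\mathbf{H}=\mathcal{H}_2\mathcal{H}_1=\mathcal{H}_1\mathcal{H}_2$ on $L^2(\mathbb{R}^2)$, where $\mathcal{H}_1,\mathcal{H}_2$ are the Hilbert transforms $\mathcal{H}f(x)=\frac1\pi\,\mathrm{p.v.}\int_{\mathbb{R}}\frac{f(t)}{x-t}\,dt$ acting in the first and the second variable respectively. Equivalently, $\mathbf{H}$ is the Fourier multiplier $\widehat{\mathbf{H}f}=\phi\hat f$ with $\phi=-1$ on the open first and third quadrants and $\phi=1$ on the open second and fourth quadrants, where $\hat f(\xi)=\frac1{2\pi}\int_{\mathbb{R}^2}e^{-i\langle\xi,z\rangle}f(z)\,dz$. *)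

theory Defs
  imports "HOL-Analysis.Analysis"
begin

text \<open>
  Functions on the plane are represented by everywhere defined representatives. For a square
  integrable function the truncated integrals below converge absolutely (for almost every section)
  and the principal value exists almost everywhere; on the remaining null set the value of
  \<^const>\<open>Lim\<close> is irrelevant.
\<close>

definition hilbert_transform :: "(real \<Rightarrow> complex) \<Rightarrow> real \<Rightarrow> complex" where
  "hilbert_transform f x =
     1 / of_real pi *
     Lim (at_right 0) (\<lambda>\<delta>. LINT t:{t. \<delta> < \<bar>x - t\<bar>}|lebesgue. f t / of_real (x - t))"

definition hilbert_fst :: "(real \<times> real \<Rightarrow> complex) \<Rightarrow> real \<times> real \<Rightarrow> complex" where
  "hilbert_fst f = (\<lambda>(x, y). hilbert_transform (\<lambda>s. f (s, y)) x)"

definition hilbert_snd :: "(real \<times> real \<Rightarrow> complex) \<Rightarrow> real \<times> real \<Rightarrow> complex" where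
  "hilbert_snd f = (\<lambda>(x, y). hilbert_transform (\<lambda>t. f (x, t)) y)"

definition double_hilbert :: "(real \<times> real \<Rightarrow> complex) \<Rightarrow> real \<times> real \<Rightarrow> complex" where
  "double_hilbert f = hilbert_snd (hilbert_fst f)"

definition L2_plane :: "(real \<times> real \<Rightarrow> complex) set" where
  "L2_plane = {f. f \<in> borel_measurable lebesgue \<and> integrable lebesgue (\<lambda>z. (cmod (f z))\<^sup>2)}"

text \<open>
  The Bochner integral of a non-integrable function is 0, so the following is the norm only on
  \<^const>\<open>L2_plane\<close>; membership has to be stated alongside it.
\<close>

definition L2_norm_plane :: "(real \<times> real \<Rightarrow> complex) \<Rightarrow> real" where
  "L2_norm_plane f = sqrt (LINT z|lebesgue. (cmod (f z))\<^sup>2)"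

end

theory Submission
  imports Defs
begin

text \<open>
  The multiplier of the double Hilbert transform is \<open>1\<close> on the antidiagonal \<open>\<xi> + \<eta> = 0\<close>, which
  carries the spectrum of functions of \<open>x - y\<close>. So \<open>V\<close> is taken to be the thin strip
  \<open>\<bar>x - y\<bar> < e\<close>, \<open>\<bar>y\<bar> < 1\<close>. Its first Hilbert transform is
  \<open>L (x - y) / \<pi>\<close> with \<open>L u = ln \<bar>(u + e) / (u - e)\<bar>\<close>, cut off to \<open>\<bar>y\<bar> < 1\<close>. Without the
  cut-off the second transform gives back the indicator of the strip exactly, because
  \<open>\<integral> ln \<bar>(b + s) / (b - s)\<bar> ds / s = sgn b \<pi>\<^sup>2 / 2\<close> over \<open>s > 0\<close>. The cut-off
  contributes the error \<open>\<integral> L (x - t) k y t dt / \<pi>\<^sup>2\<close>, where \<open>k y t = 1 / (y - t)\<close> if exactly one of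
  \<open>\<bar>t\<bar> < 1\<close>, \<open>\<bar>y\<bar> < 1\<close> holds and \<open>0\<close> otherwise. By Young's inequality with exponents \<open>4/3\<close>
  its squared norm is \<open>O(e^(3/2))\<close>, while the strip has area \<open>4 e\<close>.
\<close>

subsection \<open>The integral of the symmetric logarithm\<close>

text \<open>Grouping the Basel series in consecutive pairs separates odd from even denominators. The
  even ones make up a quarter of the whole, which leaves \<open>pi\<^sup>2 / 8\<close> for the odd
  ones.\<close>

lemma odd_inverse_squares_sums:
  "(\<lambda>n. 2 / (2 * real n + 1)\<^sup>2) sums (pi\<^sup>2 / 4)"
proof -
  have "(\<lambda>n. \<Sum>k\<in>{n * 2..<n * 2 + 2}. 1 / (real k + 1)\<^sup>2) sums (pi\<^sup>2 / 6)"
    using sums_group[OF inverse_squares_sums, of 2] by (simp add: add_ac)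
  moreover have "{n * 2..<n * 2 + 2} = {2 * n, 2 * n + 1}" for n :: nat
    by auto
  ultimately have "(\<lambda>n. 1 / (2 * real n + 1)\<^sup>2 + 1 / (2 * real n + 1 + 1)\<^sup>2) sums (pi\<^sup>2 / 6)"
    by (simp add: add_ac mult.commute)
  moreover have "(\<lambda>n. 1 / 4 * (1 / (real n + 1)\<^sup>2)) sums (1 / 4 * (pi\<^sup>2 / 6))"
    using sums_mult[OF inverse_squares_sums, of "1 / 4"] by (simp add: add_ac)
  moreover have "1 / (2 * real n + 1 + 1)\<^sup>2 = 1 / 4 * (1 / (real n + 1)\<^sup>2)" for n
    by (simp add: power2_eq_square field_simps)
  ultimately have "(\<lambda>n. 1 / (2 * real n + 1)\<^sup>2) sums (pi\<^sup>2 / 6 - 1 / 4 * (pi\<^sup>2 / 6))"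
    using sums_diff by fastforce
  from sums_mult[OF this, of 2] show ?thesis
    by (simp add: field_simps)
qed

text \<open>The function \<open>ln \<bar>b + s\<bar> / s\<close> folded at the origin: its values at
  \<open>s\<close> and \<open>- s\<close> are added. For \<open>b \<noteq> 0\<close> this removes
  the pole, as the sum tends to \<open>2 / b\<close>.\<close>

definition sym_log :: "real \<Rightarrow> real \<Rightarrow> real" where
  "sym_log b s = (ln \<bar>b + s\<bar> - ln \<bar>b - s\<bar>) / s"

lemma sym_log_measurable [measurable]: "sym_log b \<in> borel_measurable borel"
  unfolding sym_log_def by measurable

text \<open>The quadratic logarithm series at \<open>x = (1 + s) / (1 - s)\<close> is a power series
  in \<open>s\<close>; it is divided by \<open>s\<close>. Its terms are nonnegative, which later
  permits termwise integration.\<close>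

lemma sym_log_inner:
  assumes "0 < s" "s < 1"
  shows "(\<lambda>n. 2 * s ^ (2 * n) / (2 * real n + 1)) sums sym_log 1 s"
proof -
  define x where "x = (1 + s) / (1 - s)"
  have x: "x > 0" using assms by (simp add: x_def)
  have "x - 1 = 2 * s / (1 - s)" "x + 1 = 2 / (1 - s)"
    using assms by (simp_all add: x_def field_simps)
  then have "(x - 1) / (x + 1) = s"
    using assms by simp
  with ln_series_quadratic[OF x] have "(\<lambda>n. 2 * s ^ (2*n+1) / of_nat (2*n+1)) sums ln x"
    by simp
  then have "(\<lambda>n. 2 * s ^ (2*n+1) / of_nat (2*n+1) / s) sums (ln x / s)"
    by (rule sums_divide)
  moreover have "ln x / s = sym_log 1 s"
    using assms by (simp add: sym_log_def x_def ln_div)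
  moreover have "2 * s ^ (2*n+1) / of_nat (2*n+1) / s = 2 * s ^ (2 * n) / (2 * real n + 1)" for n
    using assms by simp
  ultimately show ?thesis by simp
qed

text \<open>The inner series is used at \<open>1 / s\<close>: since \<open>ln s\<close> cancels in
  the difference of logarithms, \<open>sym_log 1 s\<close> equals \<open>sym_log 1 (1 / s)\<close>
  divided by \<open>s\<^sup>2\<close>.\<close>

lemma sym_log_outer:
  assumes "1 < s"
  shows "(\<lambda>n. 2 * inverse s ^ (2 * n + 2) / (2 * real n + 1)) sums sym_log 1 s"
proof -
  have *: "(\<lambda>n. inverse s ^ 2 * (2 * inverse s ^ (2 * n) / (2 * real n + 1))) sums
      (inverse s ^ 2 * sym_log 1 (inverse s))"
    using assms by (intro sums_mult sym_log_inner) (auto simp: field_simps)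
  have **: "inverse s ^ 2 * sym_log 1 (inverse s) = sym_log 1 s"
  proof -
    have "1 + inverse s = (s + 1) / s" "1 - inverse s = (s - 1) / s"
      using assms by (auto simp: field_simps)
    moreover have "\<bar>1 - s\<bar> = s - 1" using assms by simp
    ultimately show ?thesis
      using assms by (simp add: sym_log_def ln_div power2_eq_square add_ac field_simps)
  qed
  have "inverse s ^ 2 * (2 * inverse s ^ (2 * n) / (2 * real n + 1)) =
      2 * inverse s ^ (2 * n + 2) / (2 * real n + 1)" for n
    by (simp add: power_add power2_eq_square)
  with * show ?thesis unfolding ** by (simp only:)
qed

lemma sym_log_nonneg: "0 < s \<Longrightarrow> s \<noteq> 1 \<Longrightarrow> 0 \<le> sym_log 1 s"
  by (cases "s < 1") (auto simp: sym_log_def intro!: divide_nonneg_pos)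

text \<open>The series may be integrated termwise because its terms are nonnegative. Each power
  \<open>s ^ (2 * n)\<close> contributes a second factor \<open>1 / (2 * n + 1)\<close>, so the sum
  over odd squares appears.\<close>

lemma nn_integral_sym_log_inner:
  "(\<integral>\<^sup>+ s. ennreal (sym_log 1 s) * indicator {0<..<1} s \<partial>lborel) = ennreal (pi\<^sup>2 / 4)"
proof -
  let ?f = "\<lambda>n s :: real. 2 * s ^ (2 * n) / (2 * real n + 1)"
  have "(\<integral>\<^sup>+ s. ennreal (sym_log 1 s) * indicator {0<..<1} s \<partial>lborel) =
      (\<integral>\<^sup>+ s. (\<Sum>n. ennreal (?f n s) * indicator {0<..<1} s) \<partial>lborel)"
  proof (rule nn_integral_cong)
    fix s :: real
    show "ennreal (sym_log 1 s) * indicator {0<..<1} s = (\<Sum>n. ennreal (?f n s) * indicator {0<..<1} s)"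
    proof (cases "s \<in> {0<..<1}")
      case True
      then have "(\<Sum>n. ennreal (?f n s)) = ennreal (sym_log 1 s)"
        by (intro suminf_ennreal_eq sym_log_inner) auto
      with True show ?thesis by (simp del: suminf_ennreal2)
    qed simp
  qed
  also have "\<dots> = (\<Sum>n. \<integral>\<^sup>+ s. ennreal (?f n s) * indicator {0<..<1} s \<partial>lborel)"
    by (rule nn_integral_suminf) measurable
  also have "\<dots> = (\<Sum>n. ennreal (2 / (2 * real n + 1)\<^sup>2))"
  proof (rule suminf_cong)
    fix n
    have "(\<integral>\<^sup>+ s. ennreal (?f n s) * indicator {0<..<1} s \<partial>lborel) =
        (\<integral>\<^sup>+ s. ennreal (?f n s) * indicator {0..1} s \<partial>lborel)"
    proof (rule nn_integral_cong_AE)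
      show "AE s in lborel. ennreal (?f n s) * indicator {0<..<1} s = ennreal (?f n s) * indicator {0..1} s"
        using AE_lborel_singleton[of "0::real"] AE_lborel_singleton[of "1::real"]
        by eventually_elim (auto simp: indicator_def)
    qed
    also have "\<dots> = ennreal (2 * 1 ^ (2 * n + 1) / (2 * real n + 1)\<^sup>2 - 2 * 0 ^ (2 * n + 1) / (2 * real n + 1)\<^sup>2)"
    proof (rule nn_integral_FTC_Icc[where F="\<lambda>s. 2 * s ^ (2 * n + 1) / (2 * real n + 1)\<^sup>2"])
      fix s :: real assume "s \<in> {0..1}"
      have "((\<lambda>s. 2 / (2 * real n + 1)\<^sup>2 * s ^ (2 * n + 1)) has_real_derivative
          2 / (2 * real n + 1)\<^sup>2 * (real (2 * n + 1) * s ^ (2 * n))) (at s)"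
        using DERIV_cmult[OF DERIV_power[OF DERIV_ident], of "2 / (2 * real n + 1)\<^sup>2" "2 * n + 1" s UNIV]
        by (simp add: mult_ac)
      moreover have "2 / (2 * real n + 1)\<^sup>2 * (real (2 * n + 1) * s ^ (2 * n)) = ?f n s"
        by (simp add: power2_eq_square add.commute)
      moreover have "2 / (2 * real n + 1)\<^sup>2 * s ^ (2 * n + 1) = 2 * s ^ (2 * n + 1) / (2 * real n + 1)\<^sup>2" for s :: real
        by simp
      ultimately show "((\<lambda>s. 2 * s ^ (2 * n + 1) / (2 * real n + 1)\<^sup>2) has_real_derivative ?f n s) (at s)"
        by (simp only:)
    qed auto
    finally show "(\<integral>\<^sup>+ s. ennreal (?f n s) * indicator {0<..<1} s \<partial>lborel) = ennreal (2 / (2 * real n + 1)\<^sup>2)"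
      by simp
  qed
  also have "\<dots> = ennreal (pi\<^sup>2 / 4)"
    by (rule suminf_ennreal_eq[OF _ odd_inverse_squares_sums]) simp
  finally show ?thesis .
qed

text \<open>The same argument with inverse powers: integrating
  \<open>inverse s ^ (2 * n + 2)\<close> from \<open>1\<close> to infinity again gives
  \<open>1 / (2 * n + 1)\<close>.\<close>

lemma nn_integral_sym_log_outer:
  "(\<integral>\<^sup>+ s. ennreal (sym_log 1 s) * indicator {1<..} s \<partial>lborel) = ennreal (pi\<^sup>2 / 4)"
proof -
  let ?f = "\<lambda>n s :: real. 2 * inverse s ^ (2 * n + 2) / (2 * real n + 1)"
  have "(\<integral>\<^sup>+ s. ennreal (sym_log 1 s) * indicator {1<..} s \<partial>lborel) =
      (\<integral>\<^sup>+ s. (\<Sum>n. ennreal (?f n s) * indicator {1<..} s) \<partial>lborel)"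
  proof (rule nn_integral_cong)
    fix s :: real
    show "ennreal (sym_log 1 s) * indicator {1<..} s = (\<Sum>n. ennreal (?f n s) * indicator {1<..} s)"
    proof (cases "s \<in> {1<..}")
      case True
      then have "(\<Sum>n. ennreal (?f n s)) = ennreal (sym_log 1 s)"
        by (intro suminf_ennreal_eq sym_log_outer) auto
      with True show ?thesis by (simp del: suminf_ennreal2)
    qed simp
  qed
  also have "\<dots> = (\<Sum>n. \<integral>\<^sup>+ s. ennreal (?f n s) * indicator {1<..} s \<partial>lborel)"
    by (rule nn_integral_suminf) measurable
  also have "\<dots> = (\<Sum>n. ennreal (2 / (2 * real n + 1)\<^sup>2))"
  proof (rule suminf_cong)
    fix n
    have "AE s in lborel. s \<noteq> (1::real)"
      by (rule AE_lborel_singleton)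
    then have "(\<integral>\<^sup>+ s. ennreal (?f n s) * indicator {1<..} s \<partial>lborel) =
        (\<integral>\<^sup>+ s. ennreal (?f n s) * indicator {1..} s \<partial>lborel)"
      by (intro nn_integral_cong_AE) (auto elim!: eventually_mono simp: indicator_def)
    also have "\<dots> = ennreal (0 - (- 2 * inverse 1 ^ (2 * n + 1) / (2 * real n + 1)\<^sup>2))"
    proof (rule nn_integral_FTC_atLeast[where F="\<lambda>s. - 2 * inverse s ^ (2 * n + 1) / (2 * real n + 1)\<^sup>2"])
      fix s :: real assume s: "1 \<le> s"
      have "((\<lambda>s. - 2 / (2 * real n + 1)\<^sup>2 * inverse s ^ (2 * n + 1)) has_real_derivative
          - 2 / (2 * real n + 1)\<^sup>2 * (real (2 * n + 1) * (- (inverse s ^ 2) * inverse s ^ (2 * n)))) (at s)"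
        using s DERIV_cmult[OF DERIV_power[OF DERIV_inverse[of s], of "2 * n + 1"], of "- 2 / (2 * real n + 1)\<^sup>2"]
        by (simp add: numeral_2_eq_2 mult_ac)
      moreover have "- 2 / (2 * real n + 1)\<^sup>2 * (real (2 * n + 1) * (- (inverse s ^ 2) * inverse s ^ (2 * n))) = ?f n s"
        by (simp add: power2_eq_square add.commute)
      moreover have "- 2 / (2 * real n + 1)\<^sup>2 * inverse s ^ (2 * n + 1) = - 2 * inverse s ^ (2 * n + 1) / (2 * real n + 1)\<^sup>2" for s :: real
        by simp
      ultimately show "((\<lambda>s. - 2 * inverse s ^ (2 * n + 1) / (2 * real n + 1)\<^sup>2) has_real_derivative ?f n s) (at s)"
        by (simp only:)
      show "0 \<le> ?f n s" using s by simp
    next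
      have "((\<lambda>s :: real. - 2 * inverse s ^ (2 * n + 1) / (2 * real n + 1)\<^sup>2) \<longlongrightarrow>
         - 2 * 0 ^ (2 * n + 1) / (2 * real n + 1)\<^sup>2) at_top"
        by (intro tendsto_intros tendsto_inverse_0_at_top filterlim_ident) auto
      then show "((\<lambda>s :: real. - 2 * inverse s ^ (2 * n + 1) / (2 * real n + 1)\<^sup>2) \<longlongrightarrow> 0) at_top"
        by simp
    qed measurable
    finally show "(\<integral>\<^sup>+ s. ennreal (?f n s) * indicator {1<..} s \<partial>lborel) = ennreal (2 / (2 * real n + 1)\<^sup>2)"
      by simp
  qed
  also have "\<dots> = ennreal (pi\<^sup>2 / 4)"
    by (rule suminf_ennreal_eq[OF _ odd_inverse_squares_sums]) simp
  finally show ?thesis .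
qed

lemma has_bochner_integral_sym_log_1:
  "has_bochner_integral lborel (\<lambda>s. indicator {0<..} s * sym_log 1 s) (pi\<^sup>2 / 2)"
proof (rule has_bochner_integral_nn_integral)
  show "AE s in lborel. 0 \<le> indicator {0<..} s * sym_log 1 s"
    using AE_lborel_singleton[of "1::real"]
    by eventually_elim (auto simp: indicator_def sym_log_nonneg)
  have "(\<integral>\<^sup>+ s. ennreal (indicator {0<..} s * sym_log 1 s) \<partial>lborel) =
    (\<integral>\<^sup>+ s. ennreal (sym_log 1 s) * indicator {0<..<1} s + ennreal (sym_log 1 s) * indicator {1<..} s \<partial>lborel)"
    using AE_lborel_singleton[of "1::real"]
    by (intro nn_integral_cong_AE) (auto elim!: eventually_mono simp: indicator_def)
  also have "\<dots> = ennreal (pi\<^sup>2 / 4) + ennreal (pi\<^sup>2 / 4)"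
    by (subst nn_integral_add) (auto simp: nn_integral_sym_log_inner nn_integral_sym_log_outer)
  also have "\<dots> = ennreal (pi\<^sup>2 / 2)"
    by (subst ennreal_plus[symmetric]) auto
  finally show "(\<integral>\<^sup>+ s. ennreal (indicator {0<..} s * sym_log 1 s) \<partial>lborel) = ennreal (pi\<^sup>2 / 2)" .
qed auto

text \<open>\<open>sym_log\<close> is odd in \<open>b\<close> and homogeneous of degree
  \<open>-1\<close> in \<open>b\<close> and \<open>s\<close> together, because
  \<open>ln \<bar>b\<bar>\<close> cancels in the difference. At \<open>s = \<bar>b\<bar>\<close> one
  logarithm has argument \<open>0\<close> and does not split.\<close>

lemma sym_log_scale:
  assumes "b \<noteq> 0" "s > 0" "s \<noteq> \<bar>b\<bar>"
  shows "sym_log b s = sgn b / \<bar>b\<bar> * sym_log 1 (s / \<bar>b\<bar>)"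
proof -
  have "\<bar>\<bar>b\<bar> + s\<bar> = \<bar>b\<bar> * \<bar>1 + s / \<bar>b\<bar>\<bar>" "\<bar>\<bar>b\<bar> - s\<bar> = \<bar>b\<bar> * \<bar>1 - s / \<bar>b\<bar>\<bar>"
    using assms by (simp_all add: field_simps flip: abs_mult)
  moreover have "1 + s / \<bar>b\<bar> \<noteq> 0" "1 - s / \<bar>b\<bar> \<noteq> 0"
    using assms by (auto simp: field_simps add_pos_pos abs_if split: if_splits)
  ultimately have *: "sym_log \<bar>b\<bar> s = 1 / \<bar>b\<bar> * sym_log 1 (s / \<bar>b\<bar>)"
    using assms by (simp add: sym_log_def ln_mult)
  show ?thesis
  proof (cases "b > 0")
    case False
    then have b: "b = - \<bar>b\<bar>" "sgn b = -1" using assms by auto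
    have "sym_log b s = - sym_log \<bar>b\<bar> s"
      by (subst b, unfold sym_log_def) (simp add: abs_minus_commute minus_divide_left add.commute)
    with * b show ?thesis by simp
  qed (use * in simp)
qed

text \<open>The Jacobian of scaling by \<open>\<bar>b\<bar>\<close> cancels the homogeneity factor,
  so only the sign of \<open>b\<close> survives. A difference of two such signs later reproduces an
  indicator.\<close>

lemma has_bochner_integral_sym_log:
  assumes "b \<noteq> 0"
  shows "has_bochner_integral lborel (\<lambda>s. indicator {0<..} s * sym_log b s) (sgn b * pi\<^sup>2 / 2)"
proof -
  have "has_bochner_integral lborel (\<lambda>s. indicator {0<..} (0 + inverse \<bar>b\<bar> * s) * sym_log 1 (0 + inverse \<bar>b\<bar> * s))
      ((pi\<^sup>2 / 2) /\<^sub>R \<bar>inverse \<bar>b\<bar>\<bar>)"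
    using has_bochner_integral_sym_log_1 assms
    by (subst (asm) lborel_has_bochner_integral_real_affine_iff[where c="inverse \<bar>b\<bar>" and t=0]) auto
  then have "has_bochner_integral lborel
      (\<lambda>s. sgn b / \<bar>b\<bar> * (indicator {0<..} (inverse \<bar>b\<bar> * s) * sym_log 1 (inverse \<bar>b\<bar> * s)))
      (sgn b / \<bar>b\<bar> * ((pi\<^sup>2 / 2) /\<^sub>R inverse \<bar>b\<bar>))"
    by (intro has_bochner_integral_mult_right) auto
  moreover have "sgn b / \<bar>b\<bar> * ((pi\<^sup>2 / 2) /\<^sub>R inverse \<bar>b\<bar>) = sgn b * pi\<^sup>2 / 2"
    using assms by simp
  moreover have "indicator {0<..} s * sym_log b s =
      sgn b / \<bar>b\<bar> * (indicator {0<..} (inverse \<bar>b\<bar> * s) * sym_log 1 (inverse \<bar>b\<bar> * s))"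
    if "s \<notin> {\<bar>b\<bar>}" for s
  proof (cases "s > 0")
    case True
    then have "s / \<bar>b\<bar> > 0" using assms by simp
    moreover have "inverse \<bar>b\<bar> * s = s / \<bar>b\<bar>" by (simp add: field_simps)
    ultimately show ?thesis
      using sym_log_scale[OF assms True] that True by simp
  next
    case False
    then have "\<not> inverse \<bar>b\<bar> * s > 0" using assms by (simp add: zero_less_mult_iff)
    with False show ?thesis by simp
  qed
  ultimately show ?thesis
    by (subst has_bochner_integral_discrete_difference[where X="{\<bar>b\<bar>}"]) auto
qed

subsection \<open>The Hilbert transform of a strip\<close>

text \<open>As \<open>x\<close> lies outside the interval, \<open>x - t\<close> keeps its sign there
  and \<open>- ln \<bar>x - t\<bar>\<close> is an antiderivative.\<close>

lemma has_bochner_integral_reciprocal: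
  fixes a b x :: real
  assumes "a \<le> b" "x \<notin> {a..b}"
  shows "has_bochner_integral lborel (\<lambda>t. indicator {a..b} t / (x - t)) (ln \<bar>x - a\<bar> - ln \<bar>x - b\<bar>)"
proof -
  have "has_bochner_integral lborel (\<lambda>t. 1 / (x - t) * indicator {a..b} t) (- ln \<bar>x - b\<bar> - - ln \<bar>x - a\<bar>)"
  proof (rule has_bochner_integral_FTC_Icc_real[OF assms(1)])
    fix t assume t: "a \<le> t" "t \<le> b"
    then have "x \<noteq> t" using assms by auto
    then have "((\<lambda>t. ln \<bar>x - t\<bar>) has_real_derivative - 1 / (x - t)) (at t)"
    proof (cases "t < x")
      case True
      then have "((\<lambda>t. ln (x - t)) has_real_derivative - 1 / (x - t)) (at t)"
        by (auto intro!: derivative_eq_intros)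
      moreover have "\<forall>\<^sub>F t in nhds t. ln \<bar>x - t\<bar> = ln (x - t)"
        using eventually_nhds_in_open[of "{..<x}" t] True by (auto elim!: eventually_mono)
      ultimately show ?thesis
        by (subst DERIV_cong_ev[OF refl _ refl])
    next
      case False
      with \<open>x \<noteq> t\<close> have "x < t" by simp
      then have "((\<lambda>t. ln (t - x)) has_real_derivative 1 / (t - x)) (at t)"
        by (auto intro!: derivative_eq_intros)
      moreover have "1 / (t - x) = - 1 / (x - t)" using \<open>x < t\<close> by (simp add: field_simps)
      moreover have "\<forall>\<^sub>F t in nhds t. ln \<bar>x - t\<bar> = ln (t - x)"
        using eventually_nhds_in_open[of "{x<..}" t] \<open>x < t\<close> by (auto elim!: eventually_mono)
      ultimately show ?thesis
        by (subst DERIV_cong_ev[OF refl _ refl]) auto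
    qed
    from DERIV_minus[OF this] show "((\<lambda>t. - ln \<bar>x - t\<bar>) has_real_derivative 1 / (x - t)) (at t)"
      by simp
    show "isCont (\<lambda>t. 1 / (x - t)) t"
      using \<open>x \<noteq> t\<close> by (intro continuous_intros) auto
  qed
  then show ?thesis by (simp add: mult.commute)
qed

text \<open>Every Hilbert transform below is computed through this rule. It passes from complex
  Lebesgue integrals to real Borel ones, and lets \<open>g\<close> deviate from an explicit formula
  on a countable set such as the logarithmic singularities.\<close>

lemma hilbert_transform_eqI:
  fixes f :: "real \<Rightarrow> real"
  assumes [measurable]: "f \<in> borel_measurable borel"
    and X: "countable X" "\<And>t. t \<notin> X \<Longrightarrow> g t = of_real (f t)"
    and lim: "((\<lambda>\<delta>. LINT t|lborel. indicator {t. \<delta> < \<bar>x - t\<bar>} t * (f t / (x - t))) \<longlongrightarrow> l) (at_right 0)"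
  shows "hilbert_transform g x = of_real (l / pi)"
proof -
  have "(LINT t:{t. \<delta> < \<bar>x - t\<bar>}|lebesgue. g t / of_real (x - t)) =
      complex_of_real (LINT t|lborel. indicator {t. \<delta> < \<bar>x - t\<bar>} t * (f t / (x - t)))" for \<delta>
  proof -
    have "(LINT t:{t. \<delta> < \<bar>x - t\<bar>}|lebesgue. g t / of_real (x - t)) =
        (LINT t|lebesgue. complex_of_real (indicator {t. \<delta> < \<bar>x - t\<bar>} t * (f t / (x - t))))"
      unfolding set_lebesgue_integral_def
      by (rule integral_discrete_difference[OF X(1)]) (auto simp: X(2) indicator_def)
    also have "\<dots> = (LINT t|lborel. complex_of_real (indicator {t. \<delta> < \<bar>x - t\<bar>} t * (f t / (x - t))))"
      by (rule integral_completion) measurable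
    finally show ?thesis by (simp only: integral_complex_of_real)
  qed
  moreover have "((\<lambda>\<delta>. complex_of_real (LINT t|lborel. indicator {t. \<delta> < \<bar>x - t\<bar>} t * (f t / (x - t)))) \<longlongrightarrow> of_real l) (at_right 0)"
    by (intro tendsto_of_real lim)
  ultimately show ?thesis
    by (simp add: hilbert_transform_def tendsto_Lim)
qed

lemma hilbert_transform_zero: "hilbert_transform (\<lambda>_. 0) x = 0"
  using hilbert_transform_eqI[of "\<lambda>_. 0" "{}" "\<lambda>_. 0" x 0] by simp

text \<open>The truncated integrals are eventually constant: once \<open>\<delta>\<close> is smaller
  than the distance of \<open>x\<close> to both end points, the truncation has no effect for
  \<open>x\<close> outside, and its effects on the two sides cancel for \<open>x\<close>
  inside.\<close>

lemma hilbert_transform_interval: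
  fixes a b x :: real
  assumes "a < b" "x \<noteq> a" "x \<noteq> b"
  shows "hilbert_transform (indicator {a<..<b}) x = of_real ((ln \<bar>x - a\<bar> - ln \<bar>x - b\<bar>) / pi)"
proof (rule hilbert_transform_eqI[where f="indicator {a..b}" and X="{a, b}"])
  have "\<forall>\<^sub>F \<delta> in at_right 0. \<delta> \<in> {0<..<min \<bar>x - a\<bar> \<bar>x - b\<bar>}"
    by (rule eventually_at_right_real) (use assms in auto)
  then have "\<forall>\<^sub>F \<delta> in at_right 0. (LINT t|lborel. indicator {t. \<delta> < \<bar>x - t\<bar>} t * (indicator {a..b} t / (x - t))) =
      ln \<bar>x - a\<bar> - ln \<bar>x - b\<bar>"
  proof eventually_elim
    case (elim \<delta>)
    show ?case
    proof (cases "x \<in> {a..b}")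
      case True
      \<comment> \<open>The inner end points contribute \<open>- ln \<delta>\<close> and
        \<open>ln \<delta>\<close>, which cancel.\<close>
      have "has_bochner_integral lborel (\<lambda>t. indicator {a..x - \<delta>} t / (x - t) + indicator {x + \<delta>..b} t / (x - t))
         ((ln \<bar>x - a\<bar> - ln \<bar>x - (x - \<delta>)\<bar>) + (ln \<bar>x - (x + \<delta>)\<bar> - ln \<bar>x - b\<bar>))"
        using elim True
        by (intro has_bochner_integral_add has_bochner_integral_reciprocal) auto
      then have "(LINT t|lborel. indicator {a..x - \<delta>} t / (x - t) + indicator {x + \<delta>..b} t / (x - t)) =
          ln \<bar>x - a\<bar> - ln \<bar>x - b\<bar>"
        by (simp add: has_bochner_integral_integral_eq)
      moreover have "(LINT t|lborel. indicator {t. \<delta> < \<bar>x - t\<bar>} t * (indicator {a..b} t / (x - t))) =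
          (LINT t|lborel. indicator {a..x - \<delta>} t / (x - t) + indicator {x + \<delta>..b} t / (x - t))"
        using elim True
        by (intro integral_discrete_difference[where X="{x - \<delta>, x + \<delta>}"]) (auto simp: indicator_def)
      ultimately show ?thesis by simp
    next
      case False
      have "(LINT t|lborel. indicator {t. \<delta> < \<bar>x - t\<bar>} t * (indicator {a..b} t / (x - t))) =
          (LINT t|lborel. indicator {a..b} t / (x - t))"
        using elim False by (intro Bochner_Integration.integral_cong) (auto simp: indicator_def)
      also have "\<dots> = ln \<bar>x - a\<bar> - ln \<bar>x - b\<bar>"
        using has_bochner_integral_reciprocal[of a b x] False assms
        by (simp add: has_bochner_integral_integral_eq)
      finally show ?thesis .
    qed
  qed
  then show "((\<lambda>\<delta>. LINT t|lborel. indicator {t. \<delta> < \<bar>x - t\<bar>} t * (indicator {a..b} t / (x - t))) \<longlongrightarrow>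
      ln \<bar>x - a\<bar> - ln \<bar>x - b\<bar>) (at_right 0)"
    by (rule tendsto_eventually)
qed (auto simp: indicator_def)

text \<open>The function \<open>L\<close> of the opening comment; away from \<open>u = e\<close> and
  \<open>u = - e\<close> it is \<open>pi\<close> times the Hilbert transform of the indicator of
  \<open>{- e<..<e}\<close>.\<close>

definition log_ratio :: "real \<Rightarrow> real \<Rightarrow> real" where
  "log_ratio e u = ln \<bar>u + e\<bar> - ln \<bar>u - e\<bar>"

lemma log_ratio_measurable [measurable]: "log_ratio e \<in> borel_measurable borel"
  unfolding log_ratio_def by measurable

definition strip :: "real \<Rightarrow> (real \<times> real) set" where
  "strip e = {(x, y). \<bar>x - y\<bar> < e \<and> \<bar>y\<bar> < 1}"

text \<open>The horizontal section of the strip at height \<open>y\<close> is the interval of radius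
  \<open>e\<close> about \<open>y\<close>, or empty.\<close>

lemma hilbert_fst_strip:
  assumes "0 < e" "x \<noteq> y - e" "x \<noteq> y + e"
  shows "hilbert_fst (indicator (strip e)) (x, y) = of_real (indicator {-1<..<1} y * log_ratio e (x - y) / pi)"
proof (cases "\<bar>y\<bar> < 1")
  case True
  have "(\<lambda>s. indicator (strip e) (s, y)) = (indicator {y - e<..<y + e} :: real \<Rightarrow> complex)"
    using True by (auto simp: fun_eq_iff strip_def indicator_def abs_less_iff)
  moreover have "ln \<bar>x - (y - e)\<bar> - ln \<bar>x - (y + e)\<bar> = log_ratio e (x - y)"
    by (simp add: log_ratio_def algebra_simps)
  ultimately show ?thesis
    using hilbert_transform_interval[of "y - e" "y + e" x] assms True
    by (simp add: hilbert_fst_def abs_less_iff)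
next
  case False
  then have "(\<lambda>s. indicator (strip e) (s, y)) = (\<lambda>_. 0 :: complex)"
    by (auto simp: fun_eq_iff strip_def)
  then show ?thesis
    using False by (auto simp: hilbert_fst_def hilbert_transform_zero indicator_def)
qed

subsection \<open>Power bounds for the logarithmic kernel\<close>

lemma nn_integral_abs:
  fixes h :: "real \<Rightarrow> ennreal"
  assumes [measurable]: "h \<in> borel_measurable borel"
  shows "(\<integral>\<^sup>+ s. h \<bar>s\<bar> \<partial>lborel) = 2 * (\<integral>\<^sup>+ s. h s * indicator {0..} s \<partial>lborel)"
proof -
  have "(\<integral>\<^sup>+ s. h \<bar>s\<bar> \<partial>lborel) = (\<integral>\<^sup>+ s. h s * indicator {0..} s + h (- s) * indicator {0..} (- s) \<partial>lborel)"
    using AE_lborel_singleton[of "0::real"]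
    by (intro nn_integral_cong_AE) (auto elim!: eventually_mono simp: indicator_def)
  also have "\<dots> = (\<integral>\<^sup>+ s. h s * indicator {0..} s \<partial>lborel) + (\<integral>\<^sup>+ s. h (- s) * indicator {0..} (- s) \<partial>lborel)"
    by (rule nn_integral_add) measurable
  also have "(\<integral>\<^sup>+ s. h (- s) * indicator {0..} (- s) \<partial>lborel) = (\<integral>\<^sup>+ s. h s * indicator {0..} s \<partial>lborel)"
    using nn_integral_real_affine[of "\<lambda>s. h s * indicator {0..} s" "-1" 0] by simp
  finally show ?thesis by (simp add: mult_2)
qed

text \<open>The integrand is the \<open>4/3\<close> power of the Hilbert kernel
  \<open>1 / s\<close>. Its antiderivative \<open>- 3 * s powr (-1/3)\<close> on the positive axis
  is doubled by symmetry.\<close>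

lemma nn_integral_tail:
  fixes d :: real
  assumes "0 < d"
  shows "(\<integral>\<^sup>+ s. ennreal (\<bar>s\<bar> powr (-4/3)) * indicator {s. d \<le> \<bar>s\<bar>} s \<partial>lborel) = ennreal (6 * d powr (-1/3))"
proof -
  have "(\<integral>\<^sup>+ s. ennreal (\<bar>s\<bar> powr (-4/3)) * indicator {s. d \<le> \<bar>s\<bar>} s \<partial>lborel) =
      (\<integral>\<^sup>+ s. ennreal (\<bar>s\<bar> powr (-4/3)) * indicator {d..} \<bar>s\<bar> \<partial>lborel)"
    by (intro nn_integral_cong) (auto simp: indicator_def)
  also have "\<dots> = 2 * (\<integral>\<^sup>+ s. ennreal (s powr (-4/3)) * indicator {d..} s * indicator {0..} s \<partial>lborel)"
    by (rule nn_integral_abs) measurable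
  also have "(\<integral>\<^sup>+ s. ennreal (s powr (-4/3)) * indicator {d..} s * indicator {0..} s \<partial>lborel) =
      (\<integral>\<^sup>+ s. ennreal (s powr (-4/3)) * indicator {d..} s \<partial>lborel)"
    using assms by (intro nn_integral_cong) (auto simp: indicator_def)
  also have "\<dots> = ennreal (0 - (- 3 * d powr (-1/3)))"
  proof (rule nn_integral_FTC_atLeast)
    fix s assume "d \<le> s"
    then have "s > 0" using assms by simp
    then have "((\<lambda>s. - 3 * s powr (-1/3)) has_real_derivative - 3 * ((-1/3) * s powr (-1/3 - 1))) (at s)"
      by (intro DERIV_cmult has_real_derivative_powr)
    then show "((\<lambda>s. - 3 * s powr (-1/3)) has_real_derivative s powr (-4/3)) (at s)"
      by simp
  next
    have "((\<lambda>s::real. s powr (-1/3)) \<longlongrightarrow> 0) at_top"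
      by (rule tendsto_neg_powr) (auto intro: filterlim_ident)
    from tendsto_mult_left[OF this, of "-3"] show "((\<lambda>s::real. - 3 * s powr (-1/3)) \<longlongrightarrow> 0) at_top"
      by simp
  qed auto
  also have "2 * ennreal (0 - (- 3 * d powr (-1/3))) = ennreal (6 * d powr (-1/3))"
    by (simp flip: ennreal_numeral ennreal_mult')
  finally show ?thesis .
qed

text \<open>A common integrable majorant for the logarithmic kernel and for the weight at the edges
  \<open>y = 1\<close> and \<open>y = - 1\<close>. The exponent \<open>-2/3\<close> governs small
  \<open>s\<close>, the exponent \<open>-4/3\<close> large \<open>s\<close>; one lies on each side
  of the critical exponent \<open>-1\<close>.\<close>

definition bump :: "real \<Rightarrow> real" where
  "bump s = min (\<bar>s\<bar> powr (-2/3)) (\<bar>s\<bar> powr (-4/3))"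

lemma bump_measurable [measurable]: "bump \<in> borel_measurable borel"
  unfolding bump_def by measurable

lemma bump_nonneg: "0 \<le> bump s"
  by (simp add: bump_def)

lemma nn_integral_bump_finite: "(\<integral>\<^sup>+ s. ennreal (bump s) \<partial>lborel) < \<infinity>"
proof -
  let ?f = "\<lambda>s :: real. ennreal (s powr (-2/3)) * indicator {0..1} s"
  have "((\<lambda>s :: real. s powr (-2/3)) has_integral 1 powr (-2/3 + 1) / (-2/3 + 1)) {0..1}"
    by (rule has_integral_powr_from_0) auto
  from nn_integral_has_integral_lebesgue'[OF _ this] have inner: "(\<integral>\<^sup>+ s. ?f s \<partial>lborel) < \<infinity>"
    by (simp add: ennreal_mult' ennreal_indicator)
  have "(\<integral>\<^sup>+ s. ennreal (bump s) \<partial>lborel) \<le>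
      (\<integral>\<^sup>+ s. ?f \<bar>s\<bar> + ennreal (\<bar>s\<bar> powr (-4/3)) * indicator {s. 1 \<le> \<bar>s\<bar>} s \<partial>lborel)"
    by (intro nn_integral_mono) (auto simp: bump_def indicator_def intro!: ennreal_leI)
  also have "\<dots> = (\<integral>\<^sup>+ s. ?f \<bar>s\<bar> \<partial>lborel) + (\<integral>\<^sup>+ s. ennreal (\<bar>s\<bar> powr (-4/3)) * indicator {s. 1 \<le> \<bar>s\<bar>} s \<partial>lborel)"
    by (rule nn_integral_add) measurable
  also have "\<dots> = 2 * (\<integral>\<^sup>+ s. ?f s * indicator {0..} s \<partial>lborel) + ennreal 6"
    by (subst nn_integral_abs, measurable, subst nn_integral_tail) simp_all
  also have "(\<integral>\<^sup>+ s. ?f s * indicator {0..} s \<partial>lborel) = (\<integral>\<^sup>+ s. ?f s \<partial>lborel)"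
    by (intro nn_integral_cong) (auto simp: indicator_def)
  also have "2 * (\<integral>\<^sup>+ s. ?f s \<partial>lborel) + ennreal 6 < \<infinity>"
    using inner by (simp add: ennreal_mult_less_top)
  finally show ?thesis .
qed

section \<open>Domination of the logarithmic kernel and its energy\<close>

text \<open>With \<open>r = exp (2 * s)\<close> and \<open>s \<ge> 0\<close> the claim is
  \<open>2 * s \<le> exp s - exp (- s)\<close>, which holds at \<open>0\<close> and persists because
  the difference is nondecreasing. Both sides are invariant under \<open>r \<mapsto> 1 / r\<close>,
  which settles \<open>r < 1\<close>.\<close>

lemma abs_ln_le:
  fixes r :: real
  assumes "0 < r"
  shows "\<bar>ln r\<bar> \<le> \<bar>r - 1\<bar> / sqrt r"
proof -
  have *: "ln r \<le> (r - 1) / sqrt r" if "1 \<le> r" for r :: real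
  proof -
    define s where "s = ln r / 2"
    have s: "s \<ge> 0" using that by (simp add: s_def)
    have "sqrt r = exp s" "r = exp s * exp s"
      using that by (simp_all add: s_def ln_sqrt[symmetric] flip: exp_add)
    then have eq: "(r - 1) / sqrt r = exp s - exp (- s)"
      by (simp add: exp_minus field_simps)
    have "(\<lambda>s. exp s - exp (- s) - 2 * s) 0 \<le> (\<lambda>s. exp s - exp (- s) - 2 * s) s"
    proof (rule DERIV_nonneg_imp_nondecreasing[OF s])
      fix t :: real
      have "((\<lambda>s. exp s - exp (- s) - 2 * s) has_real_derivative exp t + exp (- t) - 2) (at t)"
        by (auto intro!: derivative_eq_intros)
      moreover have "exp t + exp (- t) - 2 \<ge> 0"
        using exp_ge_add_one_self[of t] exp_ge_add_one_self[of "- t"] by linarith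
      ultimately show "\<exists>y. ((\<lambda>s. exp s - exp (- s) - 2 * s) has_real_derivative y) (at t) \<and> 0 \<le> y"
        by blast
    qed
    then show ?thesis unfolding eq by (simp add: s_def)
  qed
  show ?thesis
  proof (cases "1 \<le> r")
    case True
    then show ?thesis using *[of r] by simp
  next
    case False
    then have "- ln r \<le> (inverse r - 1) / sqrt (inverse r)"
      using *[of "inverse r"] assms by (simp add: ln_inverse one_le_inverse)
    also have "\<dots> = (1 - r) / sqrt r"
      using assms by (simp add: real_sqrt_divide real_div_sqrt field_simps)
    finally show ?thesis using False assms by simp
  qed
qed

text \<open>The previous bound is applied to the quotient of \<open>\<bar>u + 1\<bar>\<close> and
  \<open>\<bar>u - 1\<bar>\<close>, whose difference is at most \<open>2\<close> in absolute value.
  This controls the singularities at \<open>1\<close> and \<open>- 1\<close> and the decay at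
  infinity at once.\<close>

lemma abs_log_ratio_1_le:
  assumes "u \<noteq> 1" "u \<noteq> - 1"
  shows "\<bar>log_ratio 1 u\<bar> \<le> 2 / sqrt \<bar>u\<^sup>2 - 1\<bar>"
proof -
  define r where "r = \<bar>u + 1\<bar> / \<bar>u - 1\<bar>"
  have r: "0 < r" using assms by (auto simp: r_def)
  have fac: "\<bar>u\<^sup>2 - 1\<bar> = \<bar>u + 1\<bar> * \<bar>u - 1\<bar>"
    by (simp add: power2_eq_square algebra_simps flip: abs_mult)
  have sq: "sqrt \<bar>u - 1\<bar> * sqrt \<bar>u - 1\<bar> = \<bar>u - 1\<bar>" by simp
  have pos: "sqrt \<bar>u + 1\<bar> > 0" "sqrt \<bar>u - 1\<bar> > 0" "\<bar>u - 1\<bar> > 0" using assms by auto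
  have "\<bar>log_ratio 1 u\<bar> = \<bar>ln r\<bar>"
    using assms by (simp add: r_def log_ratio_def ln_div)
  also have "\<dots> \<le> \<bar>r - 1\<bar> / sqrt r"
    by (rule abs_ln_le[OF r])
  also have "\<dots> = \<bar>\<bar>u + 1\<bar> - \<bar>u - 1\<bar>\<bar> / sqrt \<bar>u\<^sup>2 - 1\<bar>"
  proof -
    have "\<bar>r - 1\<bar> = \<bar>\<bar>u + 1\<bar> - \<bar>u - 1\<bar>\<bar> / \<bar>u - 1\<bar>"
    proof -
      have "r - 1 = (\<bar>u + 1\<bar> - \<bar>u - 1\<bar>) / \<bar>u - 1\<bar>"
        using pos by (simp add: r_def diff_divide_distrib)
      then show ?thesis by simp
    qed
    moreover have "sqrt r = sqrt \<bar>u\<^sup>2 - 1\<bar> / \<bar>u - 1\<bar>"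
      unfolding r_def fac real_sqrt_divide real_sqrt_mult using pos sq
      by (simp add: field_simps)
    ultimately show ?thesis using pos by simp
  qed
  also have "\<dots> \<le> 2 / sqrt \<bar>u\<^sup>2 - 1\<bar>"
    by (intro divide_right_mono) auto
  finally show ?thesis .
qed

text \<open>With \<open>m\<close> and \<open>M\<close> the smaller and larger distance of
  \<open>u\<close> to the two singularities, \<open>\<bar>u\<^sup>2 - 1\<bar> = m * M\<close>. Near
  a singularity \<open>M \<ge> 1\<close> suffices, far away \<open>M \<ge> m\<close> supplies the
  additional decay; together they give \<open>bump m\<close>.\<close>

lemma powr_log_ratio_1_le:
  assumes "u \<noteq> 1" "u \<noteq> - 1"
  shows "\<bar>log_ratio 1 u\<bar> powr (4/3) \<le> 4 * (bump (u - 1) + bump (u + 1))"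
proof -
  define m where "m = min \<bar>u - 1\<bar> \<bar>u + 1\<bar>"
  define M where "M = max \<bar>u - 1\<bar> \<bar>u + 1\<bar>"
  have m: "0 < m" "m \<le> M" using assms by (auto simp: m_def M_def)
  \<comment> \<open>The two distances add up to at least \<open>2\<close>.\<close>
  have M: "1 \<le> M" unfolding M_def le_max_iff_disj by linarith
  have "\<bar>u\<^sup>2 - 1\<bar> = \<bar>u - 1\<bar> * \<bar>u + 1\<bar>"
    by (simp add: power2_eq_square algebra_simps flip: abs_mult)
  also have "\<dots> = m * M"
  proof -
    have "a * b = min a b * max a b" for a b :: real
      by (simp add: min_def max_def mult.commute)
    then show ?thesis by (simp only: m_def M_def)
  qed
  finally have fac: "\<bar>u\<^sup>2 - 1\<bar> = m * M" .
  have "M powr (-2/3) \<le> 1"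
    using powr_mono2'[of "-2/3" 1 M] M by simp
  moreover have "M powr (-2/3) \<le> m powr (-2/3)"
    using m by (intro powr_mono2') auto
  ultimately have "m powr (-2/3) * M powr (-2/3) \<le> min (m powr (-2/3) * 1) (m powr (-2/3) * m powr (-2/3))"
    by (intro min.boundedI mult_left_mono) auto
  also have "\<dots> = bump m"
    using m by (simp add: bump_def flip: powr_add)
  also have "\<dots> \<le> bump (u - 1) + bump (u + 1)"
  proof -
    have "m = \<bar>u - 1\<bar> \<or> m = \<bar>u + 1\<bar>" unfolding m_def min_def by presburger
    then have "bump m = bump (u - 1) \<or> bump m = bump (u + 1)" by (auto simp: bump_def)
    then show ?thesis
      using bump_nonneg[of "u - 1"] bump_nonneg[of "u + 1"] by linarith
  qed
  finally have b: "m powr (-2/3) * M powr (-2/3) \<le> bump (u - 1) + bump (u + 1)" .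
  have "\<bar>log_ratio 1 u\<bar> powr (4/3) \<le> (2 / sqrt (m * M)) powr (4/3)"
    using abs_log_ratio_1_le[OF assms] by (intro powr_mono2) (auto simp: fac)
  also have "\<dots> = 2 powr (4/3) * (m powr (-2/3) * M powr (-2/3))"
    using m by (simp add: powr_divide powr_mult powr_half_sqrt[symmetric] powr_powr powr_minus_divide)
  also have "\<dots> \<le> 4 * (m powr (-2/3) * M powr (-2/3))"
  proof -
    have "(2::real) powr (4/3) \<le> 2 powr 2" by (intro powr_mono) auto
    then show ?thesis by (intro mult_right_mono) auto
  qed
  also have "\<dots> \<le> 4 * (bump (u - 1) + bump (u + 1))"
    using b by (intro mult_left_mono) auto
  finally show ?thesis .
qed

text \<open>The \<open>4/3\<close> power of the norm of \<open>log_ratio 1\<close> in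
  \<open>L^(4/3)\<close>.\<close>

definition log_energy :: ennreal where
  "log_energy = (\<integral>\<^sup>+ u. ennreal (\<bar>log_ratio 1 u\<bar> powr (4/3)) \<partial>lborel)"

lemma nn_integral_bump_shift: "(\<integral>\<^sup>+ u. ennreal (bump (u + a)) \<partial>lborel) = (\<integral>\<^sup>+ u. ennreal (bump u) \<partial>lborel)"
  using nn_integral_real_affine[of "\<lambda>u. ennreal (bump u)" 1 a] by (simp add: add.commute)

lemma log_energy_finite: "log_energy < \<infinity>"
proof -
  have "log_energy \<le> (\<integral>\<^sup>+ u. ennreal 4 * (ennreal (bump (u + - 1)) + ennreal (bump (u + 1))) \<partial>lborel)"
    unfolding log_energy_def
  proof (rule nn_integral_mono_AE)
    show "AE u in lborel. ennreal (\<bar>log_ratio 1 u\<bar> powr (4/3)) \<le>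
        ennreal 4 * (ennreal (bump (u + - 1)) + ennreal (bump (u + 1)))"
      using AE_lborel_singleton[of "1::real"] AE_lborel_singleton[of "-1::real"]
    proof eventually_elim
      case (elim u)
      then show ?case
        using ennreal_leI[OF powr_log_ratio_1_le[of u]] by (simp add: bump_nonneg ennreal_mult')
    qed
  qed
  also have "\<dots> = 4 * ((\<integral>\<^sup>+ u. ennreal (bump u) \<partial>lborel) + (\<integral>\<^sup>+ u. ennreal (bump u) \<partial>lborel))"
    by (subst nn_integral_cmult, measurable, subst nn_integral_add) (auto simp: nn_integral_bump_shift simp del: add_uminus_conv_diff)
  also have "\<dots> < \<infinity>"
    using nn_integral_bump_finite by (simp add: ennreal_mult_less_top)
  finally show ?thesis .
qed

lemma log_ratio_scale:
  assumes "0 < e" "v \<noteq> 1" "v \<noteq> - 1"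
  shows "log_ratio e (e * v) = log_ratio 1 v"
proof -
  have "e * v + e = e * (v + 1)" "e * v - e = e * (v - 1)" by (simp_all add: algebra_simps)
  then show ?thesis
    using assms by (simp add: log_ratio_def abs_mult ln_mult)
qed

text \<open>\<open>log_ratio\<close> is homogeneous of degree \<open>0\<close> in \<open>e\<close>
  and \<open>u\<close>, so the substitution \<open>u = e * v\<close> produces only the Jacobian
  \<open>e\<close>. This linear factor is the source of smallness; Young's inequality uses it once
  in \<open>t\<close> and once in \<open>x\<close>.\<close>

lemma nn_integral_log_ratio:
  assumes "0 < e"
  shows "(\<integral>\<^sup>+ t. ennreal (\<bar>log_ratio e (x - t)\<bar> powr (4/3)) \<partial>lborel) = ennreal e * log_energy"
    and "(\<integral>\<^sup>+ x. ennreal (\<bar>log_ratio e (x - t)\<bar> powr (4/3)) \<partial>lborel) = ennreal e * log_energy"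
proof -
  let ?f = "\<lambda>u. ennreal (\<bar>log_ratio e u\<bar> powr (4/3))"
  have "(\<integral>\<^sup>+ u. ?f (e * u) \<partial>lborel) = log_energy"
    unfolding log_energy_def
  proof (rule nn_integral_cong_AE)
    show "AE u in lborel. ?f (e * u) = ennreal (\<bar>log_ratio 1 u\<bar> powr (4/3))"
      using AE_lborel_singleton[of "1::real"] AE_lborel_singleton[of "-1::real"]
      by eventually_elim (simp add: log_ratio_scale assms)
  qed
  then have *: "(\<integral>\<^sup>+ u. ?f u \<partial>lborel) = ennreal e * log_energy"
    using nn_integral_real_affine[of ?f e 0] assms by simp
  show "(\<integral>\<^sup>+ t. ennreal (\<bar>log_ratio e (x - t)\<bar> powr (4/3)) \<partial>lborel) = ennreal e * log_energy"
    using nn_integral_real_affine[of ?f "-1" x] * by simp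
  show "(\<integral>\<^sup>+ x. ennreal (\<bar>log_ratio e (x - t)\<bar> powr (4/3)) \<partial>lborel) = ennreal e * log_energy"
    using nn_integral_real_affine[of ?f 1 "-t"] * by simp
qed

section \<open>Absolute convergence away from the pole\<close>

lemma nn_integral_tail_shift:
  assumes "0 < d"
  shows "(\<integral>\<^sup>+ t. ennreal (\<bar>y - t\<bar> powr (-4/3)) * indicator {t. d \<le> \<bar>y - t\<bar>} t \<partial>lborel) = ennreal (6 * d powr (-1/3))"
proof -
  have "(\<integral>\<^sup>+ t. ennreal (\<bar>t\<bar> powr (-4/3)) * indicator {t. d \<le> \<bar>t\<bar>} t \<partial>lborel) =
    (\<integral>\<^sup>+ t. ennreal (\<bar>y - t\<bar> powr (-4/3)) * indicator {t. d \<le> \<bar>t\<bar>} (y - t) \<partial>lborel)"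
    using nn_integral_real_affine[of "\<lambda>t. ennreal (\<bar>t\<bar> powr (-4/3)) * indicator {t. d \<le> \<bar>t\<bar>} t" "-1" y] by simp
  then show ?thesis
    using nn_integral_tail[OF assms] by (simp add: indicator_def)
qed

text \<open>Young's inequality with exponents \<open>4/3\<close> and \<open>4\<close>: the logarithm
  lies in \<open>L^(4/3)\<close>, and \<open>1 / (y - t)\<close> lies in \<open>L^4\<close> at
  distance at least \<open>d\<close> from the pole.\<close>

lemma integrable_log_ratio_kernel:
  assumes "0 < e" "0 < d" and [measurable]: "S \<in> sets borel" and S: "\<And>t. t \<in> S \<Longrightarrow> d \<le> \<bar>y - t\<bar>"
  shows "integrable lborel (\<lambda>t. indicator S t * (log_ratio e (x - t) / (y - t)))"
proof (rule integrableI_bounded)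
  let ?f = "\<lambda>t. ennreal (\<bar>log_ratio e (x - t)\<bar> powr (4/3))"
  let ?g = "\<lambda>t. ennreal (\<bar>y - t\<bar> powr (-4/3)) * indicator {t. d \<le> \<bar>y - t\<bar>} t"
  have "ennreal (norm (indicator S t * (log_ratio e (x - t) / (y - t)))) \<le> ?f t + ennreal (d powr (-8/3)) * ?g t" for t
  proof (cases "t \<in> S")
    case True
    define z where "z = \<bar>y - t\<bar>"
    define a where "a = \<bar>log_ratio e (x - t)\<bar>"
    have z: "d \<le> z" "0 < z" using S[OF True] assms by (auto simp: z_def)
    have "a * (1 / z) \<le> a powr (4/3) / (4/3) + (1 / z) powr 4 / 4"
      using z by (intro Youngs_inequality) (auto simp: a_def)
    also have "(1 / z) powr 4 = z powr (-8/3) * z powr (-4/3)"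
      using z by (simp add: powr_divide powr_minus_divide flip: powr_add)
    \<comment> \<open>Trading the surplus decay for a constant reduces the exponent
      \<open>-4\<close> to the exponent \<open>-4/3\<close> of the tail integral.\<close>
    also have "z powr (-8/3) * z powr (-4/3) \<le> d powr (-8/3) * z powr (-4/3)"
      using z assms by (intro mult_right_mono powr_mono2') auto
    finally have "a * (1 / z) \<le> a powr (4/3) / (4/3) + d powr (-8/3) * z powr (-4/3) / 4"
      by simp
    also have "\<dots> \<le> a powr (4/3) + d powr (-8/3) * z powr (-4/3)"
      by (intro add_mono) auto
    finally have "a / z \<le> a powr (4/3) + d powr (-8/3) * z powr (-4/3)"
      by simp
    then show ?thesis
      using True z by (simp add: abs_divide z_def a_def flip: ennreal_plus ennreal_mult)
  qed auto
  then have "(\<integral>\<^sup>+ t. ennreal (norm (indicator S t * (log_ratio e (x - t) / (y - t)))) \<partial>lborel) \<le>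
      (\<integral>\<^sup>+ t. ?f t + ennreal (d powr (-8/3)) * ?g t \<partial>lborel)"
    by (intro nn_integral_mono)
  also have "\<dots> = (\<integral>\<^sup>+ t. ?f t \<partial>lborel) + ennreal (d powr (-8/3)) * (\<integral>\<^sup>+ t. ?g t \<partial>lborel)"
    by (subst nn_integral_add, measurable, subst nn_integral_cmult) auto
  also have "\<dots> < \<infinity>"
    unfolding nn_integral_log_ratio[OF assms(1)] nn_integral_tail_shift[OF assms(2)]
    using log_energy_finite by (simp add: ennreal_mult_less_top)
  finally show "(\<integral>\<^sup>+ t. ennreal (norm (indicator S t * (log_ratio e (x - t) / (y - t)))) \<partial>lborel) < \<infinity>" .
qed auto

subsection \<open>The double Hilbert transform of a strip\<close>

text \<open>Substituting \<open>t = y \<plusminus> s\<close> turns the truncated integral into that of a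
  function that is absolutely integrable down to \<open>s = 0\<close>.\<close>

lemma log_ratio_principal_value_folded:
  assumes "0 < e" "0 < \<delta>"
  shows "(LINT t|lborel. indicator {t. \<delta> < \<bar>y - t\<bar>} t * (log_ratio e (x - t) / (y - t))) =
    (LINT s|lborel. indicator {\<delta><..} s * (sym_log (x - y + e) s - sym_log (x - y - e) s))"
proof -
  define h where "h t = log_ratio e (x - t) / (y - t)" for t
  let ?l = "\<lambda>t. indicator {..<y - \<delta>} t * h t" and ?r = "\<lambda>t. indicator {y + \<delta><..} t * h t"
  have int: "integrable lborel ?l" "integrable lborel ?r"
    unfolding h_def by (intro integrable_log_ratio_kernel[OF assms]; force)+
  have "(LINT t|lborel. indicator {t. \<delta> < \<bar>y - t\<bar>} t * h t) = (LINT t|lborel. ?l t + ?r t)"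
    using assms by (intro Bochner_Integration.integral_cong) (auto simp: indicator_def)
  also have "\<dots> = (LINT t|lborel. ?l t) + (LINT t|lborel. ?r t)"
    by (rule Bochner_Integration.integral_add[OF int])
  also have "\<dots> = (LINT s|lborel. ?l (y + - 1 * s)) + (LINT s|lborel. ?r (y + 1 * s))"
    using lborel_integral_real_affine[of "- 1" ?l y] lborel_integral_real_affine[of 1 ?r y] by simp
  also have "\<dots> = (LINT s|lborel. ?l (y + - 1 * s) + ?r (y + 1 * s))"
    by (intro Bochner_Integration.integral_add[symmetric] lborel_integrable_real_affine int) auto
  also have "\<dots> = (LINT s|lborel. indicator {\<delta><..} s * (sym_log (x - y + e) s - sym_log (x - y - e) s))"
  proof (rule Bochner_Integration.integral_cong[OF refl])
    fix s :: real
    have "\<bar>x - y + e - s\<bar> = \<bar>x - (y + s) + e\<bar>" "\<bar>x - y - e - s\<bar> = \<bar>x - (y + s) - e\<bar>"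
      "\<bar>x - y + e + s\<bar> = \<bar>x - (y - s) + e\<bar>" "\<bar>x - y - e + s\<bar> = \<bar>x - (y - s) - e\<bar>"
      by (simp_all add: algebra_simps)
    \<comment> \<open>As \<open>y - t\<close> is \<open>s\<close> at \<open>t = y - s\<close> and
      \<open>- s\<close> at \<open>t = y + s\<close>, the four logarithms regroup according to the
      sign of \<open>e\<close>.\<close>
    then have "sym_log (x - y + e) s - sym_log (x - y - e) s = h (y - s) + h (y + s)"
      unfolding sym_log_def h_def log_ratio_def
      by (simp add: diff_divide_distrib)
    then show "?l (y + - 1 * s) + ?r (y + 1 * s) =
        indicator {\<delta><..} s * (sym_log (x - y + e) s - sym_log (x - y - e) s)"
      by (auto simp: indicator_def)
  qed
  finally show ?thesis unfolding h_def .
qed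

text \<open>The folded integrand is integrable down to \<open>s = 0\<close>, so dominated
  convergence lets the truncation tend to \<open>0\<close>. Hence the uncut second transform returns
  the indicator exactly.\<close>

lemma log_ratio_principal_value:
  assumes e: "0 < e" and xy: "\<bar>x - y\<bar> \<noteq> e"
  shows "((\<lambda>\<delta>. LINT t|lborel. indicator {t. \<delta> < \<bar>y - t\<bar>} t * (log_ratio e (x - t) / (y - t))) \<longlongrightarrow>
      pi\<^sup>2 * indicator {-e<..<e} (x - y)) (at_right 0)"
proof (rule tendsto_at_right_sequentially[where b=1])
  fix S :: "nat \<Rightarrow> real"
  assume S: "\<And>n. 0 < S n" "S \<longlonglongrightarrow> 0"
  define m where "m s = indicator {0<..} s * sym_log (x - y + e) s - indicator {0<..} s * sym_log (x - y - e) s" for s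
  have "x - y + e \<noteq> 0" "x - y - e \<noteq> 0" using xy e by auto
  then have m: "has_bochner_integral lborel m (sgn (x - y + e) * pi\<^sup>2 / 2 - sgn (x - y - e) * pi\<^sup>2 / 2)"
    unfolding m_def by (intro has_bochner_integral_diff has_bochner_integral_sym_log)
  \<comment> \<open>The two signs differ exactly when \<open>\<bar>x - y\<bar> < e\<close>;
    otherwise the terms cancel.\<close>
  have "sgn (x - y + e) * pi\<^sup>2 / 2 - sgn (x - y - e) * pi\<^sup>2 / 2 = pi\<^sup>2 * indicator {-e<..<e} (x - y)"
    using xy e by (auto simp: sgn_if indicator_def)
  with m have m': "integrable lborel m" "integral\<^sup>L lborel m = pi\<^sup>2 * indicator {-e<..<e} (x - y)"
    by (simp_all add: has_bochner_integral_iff)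
  have "(\<lambda>n. LINT s|lborel. indicator {S n<..} s * m s) \<longlonglongrightarrow> integral\<^sup>L lborel m"
  proof (rule integral_dominated_convergence[where w="\<lambda>s. norm (m s)"])
    show "AE s in lborel. (\<lambda>n. indicator {S n<..} s * m s) \<longlonglongrightarrow> m s"
    proof (rule AE_I2)
      fix s :: real
      show "(\<lambda>n. indicator {S n<..} s * m s) \<longlonglongrightarrow> m s"
      proof (cases "s > 0")
        case True
        have "\<forall>\<^sub>F n in sequentially. S n < s"
          using order_tendstoD(2)[OF S(2) True] .
        then have "\<forall>\<^sub>F n in sequentially. indicator {S n<..} s * m s = m s"
          by eventually_elim simp
        then show ?thesis by (rule tendsto_eventually)
      qed (simp add: m_def)
    qed
    show "AE s in lborel. norm (indicator {S n<..} s * m s) \<le> norm (m s)" for n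
      by (auto simp: indicator_def)
    show "integrable lborel (\<lambda>s. norm (m s))"
      by (rule integrable_norm[OF m'(1)])
  qed (use borel_measurable_integrable[OF m'(1)] in auto)
  moreover have "(LINT t|lborel. indicator {t. S n < \<bar>y - t\<bar>} t * (log_ratio e (x - t) / (y - t))) =
      (LINT s|lborel. indicator {S n<..} s * m s)" for n
    unfolding log_ratio_principal_value_folded[OF e S(1)]
    using S(1)[of n] by (intro Bochner_Integration.integral_cong) (auto simp: m_def indicator_def)
  ultimately show "(\<lambda>n. LINT t|lborel. indicator {t. S n < \<bar>y - t\<bar>} t * (log_ratio e (x - t) / (y - t)))
      \<longlonglongrightarrow> pi\<^sup>2 * indicator {-e<..<e} (x - y)"
    by (simp add: m'(2))
qed simp

section \<open>Splitting off the effect of the cut-off\<close>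

text \<open>The kernel \<open>k\<close> of the opening comment. It serves two purposes: for
  \<open>\<bar>y\<bar> < 1\<close> it collects what the cut-off removes from the uncut transform,
  for other \<open>y\<close> it gives the whole transform of the cut function.\<close>

definition cut_kernel :: "real \<Rightarrow> real \<Rightarrow> real" where
  "cut_kernel y t = (if (\<bar>t\<bar> < 1) \<noteq> (\<bar>y\<bar> < 1) then 1 / (y - t) else 0)"

lemma cut_kernel_measurable [measurable (raw)]:
  assumes [measurable]: "f \<in> borel_measurable M" "g \<in> borel_measurable M"
  shows "(\<lambda>z. cut_kernel (f z) (g z)) \<in> borel_measurable M"
  unfolding cut_kernel_def by measurable

definition cut_error :: "real \<Rightarrow> real \<times> real \<Rightarrow> real" where
  "cut_error e z = (LINT t|lborel. log_ratio e (fst z - t) * cut_kernel (snd z) t)"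

lemma cut_error_measurable [measurable]: "cut_error e \<in> borel_measurable borel"
proof -
  have "(\<lambda>z :: real \<times> real. LINT t|lborel. log_ratio e (fst z - t) * cut_kernel (snd z) t) \<in> borel_measurable (borel \<Otimes>\<^sub>M borel)"
    by measurable
  then show ?thesis
    unfolding cut_error_def borel_prod .
qed

text \<open>For \<open>\<bar>y\<bar> < 1\<close> the cut integral is the uncut principal value minus
  the part over \<open>\<bar>t\<bar> \<ge> 1\<close>. For \<open>\<bar>y\<bar> > 1\<close> the pole
  lies off the support, the indicator vanishes and only the error remains, now with a plus
  sign.\<close>

lemma double_hilbert_strip:
  assumes e: "0 < e" and y: "\<bar>y\<bar> \<noteq> 1" and xy: "\<bar>x - y\<bar> \<noteq> e"
  shows "double_hilbert (indicator (strip e)) (x, y) =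
    of_real (indicator (strip e) (x, y) + (if \<bar>y\<bar> < 1 then - 1 else 1) * cut_error e (x, y) / pi\<^sup>2)"
proof -
  define d where "d = \<bar>\<bar>y\<bar> - 1\<bar>"
  have d: "0 < d" using y by (simp add: d_def)
  \<comment> \<open>For \<open>\<delta> < d\<close> the removed window around \<open>y\<close> does
    not reach the lines \<open>\<bar>t\<bar> = 1\<close>, so the truncation affects only the side on
    which \<open>y\<close> lies.\<close>
  have near: "\<forall>\<^sub>F \<delta> in at_right 0. \<delta> \<in> {0<..<d}"
    by (rule eventually_at_right_real[OF d])
  define l where "l = pi * indicator (strip e) (x, y) + (if \<bar>y\<bar> < 1 then - 1 else 1) * cut_error e (x, y) / pi"
  have "hilbert_transform (\<lambda>t. hilbert_fst (indicator (strip e)) (x, t)) y = of_real (l / pi)"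
  proof (rule hilbert_transform_eqI[where f="\<lambda>t. indicator {-1<..<1} t * log_ratio e (x - t) / pi" and X="{x - e, x + e}"])
    show "hilbert_fst (indicator (strip e)) (x, t) = of_real (indicator {-1<..<1} t * log_ratio e (x - t) / pi)"
      if "t \<notin> {x - e, x + e}" for t
      using that by (intro hilbert_fst_strip e) auto
    let ?I = "\<lambda>\<delta>. LINT t|lborel. indicator {t. \<delta> < \<bar>y - t\<bar>} t * (indicator {-1<..<1} t * log_ratio e (x - t) / pi / (y - t))"
    let ?P = "\<lambda>\<delta>. LINT t|lborel. indicator {t. \<delta> < \<bar>y - t\<bar>} t * (log_ratio e (x - t) / (y - t))"
    show "(?I \<longlongrightarrow> l) (at_right 0)"
    proof (cases "\<bar>y\<bar> < 1")
      case True
      have ev: "\<forall>\<^sub>F \<delta> in at_right 0. ?I \<delta> = (?P \<delta> - cut_error e (x, y)) / pi"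
        using near
      proof eventually_elim
        case (elim \<delta>)
        have cut: "log_ratio e (x - t) * cut_kernel y t = indicator {t. 1 \<le> \<bar>t\<bar>} t * (log_ratio e (x - t) / (y - t))" for t
          using True by (auto simp: cut_kernel_def indicator_def)
        have "?I \<delta> = (LINT t|lborel. (indicator {t. \<delta> < \<bar>y - t\<bar>} t * (log_ratio e (x - t) / (y - t)) -
            indicator {t. 1 \<le> \<bar>t\<bar>} t * (log_ratio e (x - t) / (y - t))) / pi)"
          using elim True by (intro Bochner_Integration.integral_cong) (auto simp: indicator_def d_def)
        also have "\<dots> = (LINT t|lborel. (indicator {t. \<delta> < \<bar>y - t\<bar>} t * (log_ratio e (x - t) / (y - t)) -
            indicator {t. 1 \<le> \<bar>t\<bar>} t * (log_ratio e (x - t) / (y - t)))) / pi"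
          by simp
        also have "(LINT t|lborel. (indicator {t. \<delta> < \<bar>y - t\<bar>} t * (log_ratio e (x - t) / (y - t)) -
            indicator {t. 1 \<le> \<bar>t\<bar>} t * (log_ratio e (x - t) / (y - t)))) = ?P \<delta> - cut_error e (x, y)"
          unfolding cut_error_def fst_conv snd_conv cut
        proof (rule Bochner_Integration.integral_diff)
          show "integrable lborel (\<lambda>t. indicator {t. \<delta> < \<bar>y - t\<bar>} t * (log_ratio e (x - t) / (y - t)))"
            using elim by (intro integrable_log_ratio_kernel[OF e, of \<delta>]) auto
          show "integrable lborel (\<lambda>t. indicator {t. 1 \<le> \<bar>t\<bar>} t * (log_ratio e (x - t) / (y - t)))"
            using True by (intro integrable_log_ratio_kernel[OF e d]) (auto simp: d_def)
        qed
        finally show ?case .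
      qed
      have lim: "((\<lambda>\<delta>. (?P \<delta> - cut_error e (x, y)) / pi) \<longlongrightarrow>
          (pi\<^sup>2 * indicator {-e<..<e} (x - y) - cut_error e (x, y)) / pi) (at_right 0)"
        by (intro tendsto_intros log_ratio_principal_value e xy) auto
      have "(pi\<^sup>2 * indicator {-e<..<e} (x - y) - cut_error e (x, y)) / pi = l"
        using True by (auto simp: l_def strip_def indicator_def power2_eq_square diff_divide_distrib)
      with lim show ?thesis
        unfolding tendsto_cong[OF ev] by (simp only:)
    next
      case False
      have "\<forall>\<^sub>F \<delta> in at_right 0. ?I \<delta> = l"
        using near
      proof eventually_elim
        case (elim \<delta>)
        have "?I \<delta> = (LINT t|lborel. log_ratio e (x - t) * cut_kernel y t / pi)"
          using elim False by (intro Bochner_Integration.integral_cong) (auto simp: indicator_def d_def cut_kernel_def)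
        also have "\<dots> = cut_error e (x, y) / pi"
          by (simp add: cut_error_def)
        also have "\<dots> = l" using False by (simp add: l_def strip_def)
        finally show ?case .
      qed
      then show ?thesis by (rule tendsto_eventually)
    qed
  qed auto
  moreover have "l / pi = indicator (strip e) (x, y) + (if \<bar>y\<bar> < 1 then - 1 else 1) * cut_error e (x, y) / pi\<^sup>2"
    by (simp add: l_def add_divide_distrib power2_eq_square)
  ultimately show ?thesis
    by (simp add: double_hilbert_def hilbert_snd_def)
qed

subsection \<open>The error term\<close>

text \<open>The size, up to a constant, of the \<open>4/3\<close> energy of
  \<open>cut_kernel y\<close>: a mild singularity at the edge and the decay of the kernel of an
  interval of length \<open>2\<close> far away.\<close>

definition edge_weight :: "real \<Rightarrow> real" where
  "edge_weight y = (let d = \<bar>\<bar>y\<bar> - 1\<bar> in min (d powr (-1/3)) (d powr (-4/3)))"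

lemma edge_weight_measurable [measurable]: "edge_weight \<in> borel_measurable borel"
  unfolding edge_weight_def Let_def by measurable

lemma edge_weight_nonneg: "0 \<le> edge_weight y"
  by (simp add: edge_weight_def Let_def)

text \<open>The exponents \<open>1/3\<close> and \<open>2/3\<close> near the edge are at most
  \<open>2/3\<close>, the exponents \<open>4/3\<close> and \<open>8/3\<close> far away at least
  \<open>4/3\<close>. Weight and square are both needed since the Young estimate has terms of degree
  one and two in the kernel energy.\<close>

lemma edge_weight_le:
  assumes "\<bar>y\<bar> \<noteq> 1"
  shows "edge_weight y \<le> bump (y - 1) + bump (y + 1)"
    and "(edge_weight y)\<^sup>2 \<le> bump (y - 1) + bump (y + 1)"
proof -
  define d where "d = \<bar>\<bar>y\<bar> - 1\<bar>"
  have d: "0 < d" using assms by (simp add: d_def)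
  have "d = \<bar>y - 1\<bar> \<or> d = \<bar>y + 1\<bar>"
    unfolding d_def by linarith
  then have "bump d = bump (y - 1) \<or> bump d = bump (y + 1)"
    by (auto simp: bump_def)
  then have *: "bump d \<le> bump (y - 1) + bump (y + 1)"
    using bump_nonneg[of "y - 1"] bump_nonneg[of "y + 1"] by linarith
  have w: "edge_weight y = min (d powr (-1/3)) (d powr (-4/3))"
    by (simp add: edge_weight_def d_def Let_def)
  have "edge_weight y \<le> bump d \<and> (edge_weight y)\<^sup>2 \<le> bump d"
  proof (cases "d \<le> 1")
    case True
    then have "d powr (-1/3) \<le> d powr (-4/3)" "d powr (-1/3) \<le> d powr (-2/3)" "d powr (-2/3) \<le> d powr (-4/3)"
      using d by (auto intro!: powr_mono')
    moreover have "(d powr (-1/3))\<^sup>2 = d powr (-2/3)"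
      by (simp add: power2_eq_square flip: powr_add)
    ultimately show ?thesis using d unfolding w by (simp add: bump_def)
  next
    case False
    then have "d powr (-4/3) \<le> d powr (-1/3)" "d powr (-4/3) \<le> d powr (-2/3)" "d powr (-8/3) \<le> d powr (-4/3)"
      by (auto intro!: powr_mono)
    moreover have "(d powr (-4/3))\<^sup>2 = d powr (-8/3)"
      by (simp add: power2_eq_square flip: powr_add)
    ultimately show ?thesis using d unfolding w by (simp add: bump_def)
  qed
  with * show "edge_weight y \<le> bump (y - 1) + bump (y + 1)"
    "(edge_weight y)\<^sup>2 \<le> bump (y - 1) + bump (y + 1)" by linarith+
qed

text \<open>Where the kernel is nonzero, \<open>t\<close> and \<open>y\<close> lie on opposite sides
  of the edge, hence at distance at least \<open>d\<close>; the tail integral gives the first bound.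
  If \<open>d > 1\<close>, then \<open>y\<close> is outside and the kernel lives on
  \<open>\<bar>t\<bar> < 1\<close>, which gives the second.\<close>

lemma nn_integral_cut_kernel_le:
  assumes "\<bar>y\<bar> \<noteq> 1"
  shows "(\<integral>\<^sup>+ t. ennreal (\<bar>cut_kernel y t\<bar> powr (4/3)) \<partial>lborel) \<le> ennreal (6 * edge_weight y)"
proof -
  define d where "d = \<bar>\<bar>y\<bar> - 1\<bar>"
  have d: "0 < d" using assms by (simp add: d_def)
  have w: "edge_weight y = min (d powr (-1/3)) (d powr (-4/3))"
    by (simp add: edge_weight_def d_def Let_def)
  have kernel: "\<bar>cut_kernel y t\<bar> powr (4/3) = \<bar>y - t\<bar> powr (-4/3) \<and> d \<le> \<bar>y - t\<bar>"
    if "cut_kernel y t \<noteq> 0" for t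
  proof -
    have "(\<bar>t\<bar> < 1) \<noteq> (\<bar>y\<bar> < 1)" by (rule ccontr) (use that in \<open>simp add: cut_kernel_def\<close>)
    then have "d \<le> \<bar>y - t\<bar>" unfolding d_def by (cases "\<bar>y\<bar> < 1") auto
    then show ?thesis
      using \<open>(\<bar>t\<bar> < 1) \<noteq> (\<bar>y\<bar> < 1)\<close> d
      by (auto simp: cut_kernel_def powr_divide powr_minus_divide)
  qed
  have "(\<integral>\<^sup>+ t. ennreal (\<bar>cut_kernel y t\<bar> powr (4/3)) \<partial>lborel) \<le>
      (\<integral>\<^sup>+ t. ennreal (\<bar>y - t\<bar> powr (-4/3)) * indicator {t. d \<le> \<bar>y - t\<bar>} t \<partial>lborel)"
  proof (rule nn_integral_mono)
    show "ennreal (\<bar>cut_kernel y t\<bar> powr (4/3)) \<le> ennreal (\<bar>y - t\<bar> powr (-4/3)) * indicator {t. d \<le> \<bar>y - t\<bar>} t" for t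
      using kernel[of t] by (cases "cut_kernel y t = 0") auto
  qed
  also have "\<dots> = ennreal (6 * d powr (-1/3))"
    by (rule nn_integral_tail_shift[OF d])
  finally have near: "(\<integral>\<^sup>+ t. ennreal (\<bar>cut_kernel y t\<bar> powr (4/3)) \<partial>lborel) \<le> ennreal (6 * d powr (-1/3))" .
  show ?thesis
  proof (cases "d \<le> 1")
    case True
    then have "d powr (-1/3) \<le> d powr (-4/3)"
      using d by (auto intro!: powr_mono')
    then show ?thesis using near by (simp add: w)
  next
    case False
    then have y: "\<not> \<bar>y\<bar> < 1" by (auto simp: d_def)
    have "(\<integral>\<^sup>+ t. ennreal (\<bar>cut_kernel y t\<bar> powr (4/3)) \<partial>lborel) \<le>
        (\<integral>\<^sup>+ t. ennreal (d powr (-4/3)) * indicator {-1..1::real} t \<partial>lborel)"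
    proof (rule nn_integral_mono)
      fix t :: real
      show "ennreal (\<bar>cut_kernel y t\<bar> powr (4/3)) \<le> ennreal (d powr (-4/3)) * indicator {-1..1::real} t"
      proof (cases "cut_kernel y t = 0")
        case False
        then have "t \<in> {-1..1}" using y by (auto simp: cut_kernel_def split: if_splits)
        moreover have "\<bar>y - t\<bar> powr (-4/3) \<le> d powr (-4/3)"
          using kernel[OF False] d by (intro powr_mono2') auto
        ultimately show ?thesis using kernel[OF False] by simp
      qed simp
    qed
    also have "\<dots> = ennreal (2 * d powr (-4/3))"
      by (subst nn_integral_cmult) (auto simp: ennreal_mult' mult.commute)
    also have "\<dots> \<le> ennreal (6 * d powr (-4/3))"
      by (intro ennreal_leI mult_right_mono) auto
    finally show ?thesis using near by (simp add: w min_def)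
  qed
qed

text \<open>
  Young's convolution inequality \<open>L^(4/3) * L^(4/3) \<rightarrow> L^2\<close> through Cauchy--Schwarz: the product
  \<open>a k\<close> is split as \<open>(a k)^(2/3) (a k)^(1/3)\<close>, and the parameter \<open>c\<close> balances the two terms of
  the arithmetic-geometric mean estimate of the second factor. It is later taken to be \<open>e^(-1/2)\<close>.
\<close>

lemma cut_error_sq_le:
  assumes "0 < c" "0 < e"
  shows "(ennreal \<bar>cut_error e (x, y)\<bar>)\<^sup>2 \<le>
    (\<integral>\<^sup>+ t. ennreal (\<bar>log_ratio e (x - t)\<bar> powr (4/3)) * ennreal (\<bar>cut_kernel y t\<bar> powr (4/3)) \<partial>lborel) *
    (ennreal (c * e) * log_energy + ennreal (1 / c) * (\<integral>\<^sup>+ t. ennreal (\<bar>cut_kernel y t\<bar> powr (4/3)) \<partial>lborel))"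
proof -
  let ?a = "\<lambda>t. \<bar>log_ratio e (x - t)\<bar>" and ?k = "\<lambda>t. \<bar>cut_kernel y t\<bar>"
  let ?F = "\<lambda>t. ennreal (?a t powr (2/3) * ?k t powr (2/3))"
  let ?G = "\<lambda>t. ennreal (?a t powr (1/3) * ?k t powr (1/3))"
  have "ennreal \<bar>cut_error e (x, y)\<bar> \<le> (\<integral>\<^sup>+ t. ennreal (norm (log_ratio e (x - t) * cut_kernel y t)) \<partial>lborel)"
  \<comment> \<open>Without integrability the integral defining \<open>cut_error\<close> is
    \<open>0\<close> by default, and the bound is trivial.\<close>
  proof (cases "integrable lborel (\<lambda>t. log_ratio e (x - t) * cut_kernel y t)")
    case True
    from integral_norm_bound_ennreal[OF this] show ?thesis by (simp add: cut_error_def)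
  qed (simp add: cut_error_def not_integrable_integral_eq)
  also have "\<dots> = (\<integral>\<^sup>+ t. ?F t * ?G t \<partial>lborel)"
  proof (rule nn_integral_cong)
    fix t :: real
    have "b powr (2/3) * b powr (1/3) = b" if "b \<ge> 0" for b :: real
      using that by (simp flip: powr_add)
    from this[of "?a t"] this[of "?k t"]
    have "(?a t powr (2/3) * ?k t powr (2/3)) * (?a t powr (1/3) * ?k t powr (1/3)) = ?a t * ?k t"
      by (simp add: mult_ac)
    then show "ennreal (norm (log_ratio e (x - t) * cut_kernel y t)) = ?F t * ?G t"
      by (simp add: abs_mult flip: ennreal_mult)
  qed
  finally have "(ennreal \<bar>cut_error e (x, y)\<bar>)\<^sup>2 \<le> (\<integral>\<^sup>+ t. ?F t * ?G t \<partial>lborel)\<^sup>2"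
    by (rule power_mono) simp
  also have "\<dots> \<le> (\<integral>\<^sup>+ t. (?F t)\<^sup>2 \<partial>lborel) * (\<integral>\<^sup>+ t. (?G t)\<^sup>2 \<partial>lborel)"
    by (rule Cauchy_Schwarz_nn_integral) measurable
  also have "(\<integral>\<^sup>+ t. (?F t)\<^sup>2 \<partial>lborel) =
      (\<integral>\<^sup>+ t. ennreal (?a t powr (4/3)) * ennreal (?k t powr (4/3)) \<partial>lborel)"
  proof (rule nn_integral_cong)
    fix t :: real
    have "(b powr (2/3))\<^sup>2 = b powr (4/3)" for b :: real
      by (simp add: power2_eq_square flip: powr_add)
    then show "(?F t)\<^sup>2 = ennreal (?a t powr (4/3)) * ennreal (?k t powr (4/3))"
      by (simp add: ennreal_power power_mult_distrib flip: ennreal_mult)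
  qed
  also have "(\<integral>\<^sup>+ t. (?G t)\<^sup>2 \<partial>lborel) \<le>
      (\<integral>\<^sup>+ t. ennreal c * ennreal (?a t powr (4/3)) + ennreal (1 / c) * ennreal (?k t powr (4/3)) \<partial>lborel)"
  proof (rule nn_integral_mono)
    fix t :: real
    define p q where "p = ?a t powr (2/3)" and "q = ?k t powr (2/3)"
    have sq: "p\<^sup>2 = ?a t powr (4/3)" "q\<^sup>2 = ?k t powr (4/3)"
      by (simp_all add: p_def q_def power2_eq_square flip: powr_add)
    have nn: "0 \<le> p" "0 \<le> q" by (simp_all add: p_def q_def)
    have "(b powr (1/3))\<^sup>2 = b powr (2/3)" for b :: real
      by (simp add: power2_eq_square flip: powr_add)
    then have "(?a t powr (1/3) * ?k t powr (1/3))\<^sup>2 = p * q"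
      by (simp add: power_mult_distrib p_def q_def)
    also have "\<dots> \<le> c * p\<^sup>2 + 1 / c * q\<^sup>2"
    proof -
      \<comment> \<open>The weighted arithmetic-geometric mean inequality comes from this square;
        its factor \<open>1/2\<close> is given away.\<close>
      have "(c * p - q)\<^sup>2 = c * (c * p\<^sup>2) + q\<^sup>2 - 2 * (c * (p * q))"
        by (simp add: power2_eq_square algebra_simps)
      moreover have "0 \<le> (c * p - q)\<^sup>2" by simp
      ultimately have "2 * (c * (p * q)) \<le> c * (c * p\<^sup>2) + q\<^sup>2" by linarith
      moreover have "0 \<le> c * (p * q)" using assms nn by simp
      ultimately have "c * (p * q) \<le> c * (c * p\<^sup>2) + q\<^sup>2" by linarith
      also have "\<dots> = c * (c * p\<^sup>2 + 1 / c * q\<^sup>2)" using assms by (simp add: distrib_left)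
      finally show ?thesis using assms by simp
    qed
    finally show "(?G t)\<^sup>2 \<le> ennreal c * ennreal (?a t powr (4/3)) + ennreal (1 / c) * ennreal (?k t powr (4/3))"
      using assms by (simp add: ennreal_power sq flip: ennreal_mult ennreal_plus)
  qed
  also have "\<dots> = ennreal c * (\<integral>\<^sup>+ t. ennreal (?a t powr (4/3)) \<partial>lborel) +
      ennreal (1 / c) * (\<integral>\<^sup>+ t. ennreal (?k t powr (4/3)) \<partial>lborel)"
    by (subst nn_integral_add, measurable, subst (1 2) nn_integral_cmult) auto
  also have "ennreal c * (\<integral>\<^sup>+ t. ennreal (?a t powr (4/3)) \<partial>lborel) = ennreal (c * e) * log_energy"
    using assms by (simp add: nn_integral_log_ratio ennreal_mult mult.assoc)
  finally show ?thesis by (simp add: mult_left_mono)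
qed

section \<open>Integration of the squared error over the plane\<close>

text \<open>Only the first factor of the pointwise bound depends on \<open>x\<close>; by Tonelli its
  integral is \<open>e * log_energy\<close> times the kernel energy. What remains is linear and
  quadratic in the edge weight, and bumps dominate both terms.\<close>

lemma cut_error_section:
  assumes "0 < c" "0 < e" "\<bar>y\<bar> \<noteq> 1"
  defines "A \<equiv> enn2real log_energy"
  shows "(\<integral>\<^sup>+ x. (ennreal \<bar>cut_error e (x, y)\<bar>)\<^sup>2 \<partial>lborel) \<le>
    ennreal (6 * e * A * (c * e * A + 6 / c)) * ennreal (bump (y - 1) + bump (y + 1))"
proof -
  let ?a = "\<lambda>x t. ennreal (\<bar>log_ratio e (x - t)\<bar> powr (4/3))" and ?k = "\<lambda>t. ennreal (\<bar>cut_kernel y t\<bar> powr (4/3))"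
  define K where "K = (\<integral>\<^sup>+ t. ?k t \<partial>lborel)"
  have A: "log_energy = ennreal A" "0 \<le> A"
    using log_energy_finite by (simp_all add: A_def)
  have K: "K \<le> ennreal (6 * edge_weight y)"
    unfolding K_def by (rule nn_integral_cut_kernel_le[OF assms(3)])
  have "(\<integral>\<^sup>+ x. (ennreal \<bar>cut_error e (x, y)\<bar>)\<^sup>2 \<partial>lborel) \<le>
      (\<integral>\<^sup>+ x. (\<integral>\<^sup>+ t. ?a x t * ?k t \<partial>lborel) * (ennreal (c * e) * log_energy + ennreal (1 / c) * K) \<partial>lborel)"
    unfolding K_def by (intro nn_integral_mono cut_error_sq_le assms)
  also have "\<dots> = (\<integral>\<^sup>+ x. (\<integral>\<^sup>+ t. ?a x t * ?k t \<partial>lborel) \<partial>lborel) * (ennreal (c * e) * log_energy + ennreal (1 / c) * K)"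
    by (rule nn_integral_multc) measurable
  also have "(\<integral>\<^sup>+ x. (\<integral>\<^sup>+ t. ?a x t * ?k t \<partial>lborel) \<partial>lborel) = (\<integral>\<^sup>+ t. (\<integral>\<^sup>+ x. ?a x t * ?k t \<partial>lborel) \<partial>lborel)"
    by (rule lborel_pair.Fubini'[symmetric]) measurable
  also have "\<dots> = (\<integral>\<^sup>+ t. ennreal e * log_energy * ?k t \<partial>lborel)"
    using assms by (intro nn_integral_cong, subst nn_integral_multc) (auto simp: nn_integral_log_ratio)
  also have "\<dots> = ennreal e * log_energy * K"
    unfolding K_def by (rule nn_integral_cmult) measurable
  also have "ennreal e * log_energy * K * (ennreal (c * e) * log_energy + ennreal (1 / c) * K) \<le>
     ennreal e * log_energy * ennreal (6 * edge_weight y) *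
     (ennreal (c * e) * log_energy + ennreal (1 / c) * ennreal (6 * edge_weight y))"
    by (intro mult_mono add_mono K) auto
  also have "\<dots> = ennreal (e * A * (6 * edge_weight y) * (c * e * A + 1 / c * (6 * edge_weight y)))"
    unfolding A(1) using assms(1,2) A(2) edge_weight_nonneg[of y] by (simp flip: ennreal_mult ennreal_plus)
  also have "\<dots> \<le> ennreal (6 * e * A * (c * e * A + 6 / c) * (bump (y - 1) + bump (y + 1)))"
  proof (rule ennreal_leI)
    have "e * A * (6 * edge_weight y) * (c * e * A + 1 / c * (6 * edge_weight y)) =
       6 * e * A * (c * e * A * edge_weight y + 6 / c * (edge_weight y)\<^sup>2)"
      by (simp add: power2_eq_square algebra_simps)
    also have "\<dots> \<le> 6 * e * A * (c * e * A * (bump (y - 1) + bump (y + 1)) + 6 / c * (bump (y - 1) + bump (y + 1)))"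
      using assms A edge_weight_le[OF assms(3)]
      by (intro mult_left_mono add_mono) auto
    also have "\<dots> = 6 * e * A * (c * e * A + 6 / c) * (bump (y - 1) + bump (y + 1))"
      by (simp add: algebra_simps add_divide_distrib)
    finally show "e * A * (6 * edge_weight y) * (c * e * A + 1 / c * (6 * edge_weight y)) \<le>
       6 * e * A * (c * e * A + 6 / c) * (bump (y - 1) + bump (y + 1))" .
  qed
  also have "\<dots> = ennreal (6 * e * A * (c * e * A + 6 / c)) * ennreal (bump (y - 1) + bump (y + 1))"
    using assms A by (intro ennreal_mult) (auto simp: bump_nonneg)
  finally show ?thesis .
qed

text \<open>Integrating the section bound over \<open>y\<close> costs only the finite mass of two
  bumps. The exponent \<open>3/2\<close> matters because it exceeds that of the area, which is
  linear in \<open>e\<close>.\<close>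

lemma cut_error_L2_bound:
  obtains C where "0 \<le> C" "\<And>e. 0 < e \<Longrightarrow>
    (\<integral>\<^sup>+ z. (ennreal \<bar>cut_error e z\<bar>)\<^sup>2 \<partial>lborel) \<le> ennreal (C * e powr (3/2))"
proof
  define A where "A = enn2real log_energy"
  define B where "B = enn2real (\<integral>\<^sup>+ u. ennreal (bump u) \<partial>lborel)"
  have B: "(\<integral>\<^sup>+ u. ennreal (bump u) \<partial>lborel) = ennreal B" "0 \<le> B"
    using nn_integral_bump_finite by (simp_all add: B_def)
  have A: "0 \<le> A" by (simp add: A_def)
  show "0 \<le> 12 * A * (A + 6) * B" using A B by simp
  fix e :: real assume e: "0 < e"
  \<comment> \<open>With this choice \<open>e * (c * e)\<close> and \<open>e / c\<close> both equal
    \<open>e powr (3/2)\<close>.\<close>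
  define c where "c = e powr (-1/2)"
  have c: "0 < c" using e by (simp add: c_def)
  have [measurable]: "cut_error e \<in> borel_measurable (borel \<Otimes>\<^sub>M borel)"
    using cut_error_measurable[of e] by (simp only: borel_prod)
  have "(\<integral>\<^sup>+ z. (ennreal \<bar>cut_error e z\<bar>)\<^sup>2 \<partial>lborel) =
      (\<integral>\<^sup>+ z. (ennreal \<bar>cut_error e z\<bar>)\<^sup>2 \<partial>(lborel \<Otimes>\<^sub>M lborel))"
    by (simp only: lborel_prod)
  also have "\<dots> = (\<integral>\<^sup>+ y. (\<integral>\<^sup>+ x. (ennreal \<bar>cut_error e (x, y)\<bar>)\<^sup>2 \<partial>lborel) \<partial>lborel)"
    by (rule lborel_pair.nn_integral_snd[symmetric]) measurable
  also have "\<dots> \<le> (\<integral>\<^sup>+ y. ennreal (6 * e * A * (c * e * A + 6 / c)) * ennreal (bump (y - 1) + bump (y + 1)) \<partial>lborel)"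
  proof (rule nn_integral_mono_AE)
    show "AE y in lborel. (\<integral>\<^sup>+ x. (ennreal \<bar>cut_error e (x, y)\<bar>)\<^sup>2 \<partial>lborel) \<le>
        ennreal (6 * e * A * (c * e * A + 6 / c)) * ennreal (bump (y - 1) + bump (y + 1))"
      using AE_lborel_singleton[of "1::real"] AE_lborel_singleton[of "-1::real"]
    proof eventually_elim
      case (elim y)
      then have "\<bar>y\<bar> \<noteq> 1" by auto
      then show ?case using cut_error_section[OF c e, of y] by (simp add: A_def)
    qed
  qed
  also have "\<dots> = ennreal (6 * e * A * (c * e * A + 6 / c)) *
      (\<integral>\<^sup>+ y. ennreal (bump (y + - 1)) + ennreal (bump (y + 1)) \<partial>lborel)"
    by (subst nn_integral_cmult) (auto simp: bump_nonneg)
  also have "(\<integral>\<^sup>+ y. ennreal (bump (y + - 1)) + ennreal (bump (y + 1)) \<partial>lborel) = ennreal B + ennreal B"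
    by (subst nn_integral_add) (auto simp: nn_integral_bump_shift B simp del: add_uminus_conv_diff)
  also have "ennreal (6 * e * A * (c * e * A + 6 / c)) * (ennreal B + ennreal B) =
      ennreal (6 * e * A * (c * e * A + 6 / c) * (B + B))"
    using e c A B by (simp flip: ennreal_plus ennreal_mult)
  also have "6 * e * A * (c * e * A + 6 / c) * (B + B) = 12 * A * (A + 6) * B * e powr (3/2)"
  proof -
    have "e powr 1 * e powr 1 * e powr (-1/2) = e powr (3/2)" "e powr 1 * e powr (1/2) = e powr (3/2)"
      by (simp_all only: powr_add[symmetric]) simp_all
    moreover have "e powr (1/2) = 1 / c" by (simp add: c_def powr_minus_divide)
    ultimately have "e * e * c = e powr (3/2)" "e * (1 / c) = e powr (3/2)"
      using e by (simp_all add: c_def)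
    moreover have "6 * e * A * (c * e * A + 6 / c) * (B + B) = 12 * A * B * (A * (e * e * c) + 6 * (e * (1 / c)))"
      by (simp add: algebra_simps)
    ultimately show ?thesis by (simp only:) (simp add: algebra_simps)
  qed
  finally show "(\<integral>\<^sup>+ z. (ennreal \<bar>cut_error e z\<bar>)\<^sup>2 \<partial>lborel) \<le> ennreal (12 * A * (A + 6) * B * e powr (3/2))" .
qed

subsection \<open>Norms\<close>

lemma open_strip: "open (strip e)"
proof -
  have "strip e = {z. \<bar>fst z - snd z\<bar> < e} \<inter> {z. \<bar>snd z\<bar> < 1}"
    by (auto simp: strip_def)
  then show ?thesis
    by (auto intro!: open_Int open_Collect_less continuous_intros)
qed

lemma bounded_strip: "bounded (strip e)"
proof -
  have "strip e \<subseteq> cbox (- (e + 1), - 1) (e + 1, 1)"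
    by (auto simp: strip_def cbox_Pair_eq)
  then show ?thesis
    using bounded_cbox bounded_subset by blast
qed

lemma strip_measurable [measurable]: "strip e \<in> sets borel"
  using open_strip by auto

lemma emeasure_strip:
  assumes "0 < e"
  shows "emeasure lborel (strip e) = ennreal (4 * e)"
proof -
  have [measurable]: "strip e \<in> sets (borel \<Otimes>\<^sub>M borel)"
    using strip_measurable[of e] by (simp only: borel_prod)
  have "emeasure lborel (strip e) = (\<integral>\<^sup>+ z. indicator (strip e) z \<partial>(lborel \<Otimes>\<^sub>M lborel))"
    by (simp add: lborel_prod)
  also have "\<dots> = (\<integral>\<^sup>+ y. (\<integral>\<^sup>+ x. indicator (strip e) (x, y) \<partial>lborel) \<partial>lborel)"
    by (rule lborel_pair.nn_integral_snd[symmetric]) measurable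
  also have "\<dots> = (\<integral>\<^sup>+ y. ennreal (2 * e) * indicator {-1<..<1::real} y \<partial>lborel)"
  proof (rule nn_integral_cong)
    fix y :: real
    have "(\<integral>\<^sup>+ x. indicator (strip e) (x, y) \<partial>lborel) =
        (\<integral>\<^sup>+ x. indicator {-1<..<1::real} y * indicator {y - e<..<y + e} x \<partial>lborel)"
      by (intro nn_integral_cong) (auto simp: strip_def indicator_def)
    also have "\<dots> = indicator {-1<..<1::real} y * ennreal (2 * e)"
      using assms by (subst nn_integral_cmult) auto
    finally show "(\<integral>\<^sup>+ x. indicator (strip e) (x, y) \<partial>lborel) = ennreal (2 * e) * indicator {-1<..<1::real} y"
      by (simp add: mult.commute)
  qed
  also have "\<dots> = ennreal (2 * e) * ennreal 2"
    by (subst nn_integral_cmult) auto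
  also have "\<dots> = ennreal (4 * e)"
    using assms by (subst ennreal_mult[symmetric]) auto
  finally show ?thesis .
qed

lemma L2_norm_plane_strip:
  assumes "0 < e"
  shows "L2_norm_plane (indicator (strip e)) = sqrt (4 * e)"
proof -
  have "(LINT z|lebesgue. (cmod (indicator (strip e) z))\<^sup>2) = (LINT z|lebesgue. indicator (strip e) z)"
    by (intro Bochner_Integration.integral_cong) (auto simp: indicator_def)
  also have "\<dots> = (LINT z|lborel. indicator (strip e) z)"
    by (rule integral_completion) measurable
  also have "\<dots> = 4 * e"
    using assms by (simp add: measure_def emeasure_strip)
  finally show ?thesis by (simp add: L2_norm_plane_def)
qed

section \<open>Square integrability and distance to the indicator\<close>

text \<open>The excluded points lie on four lines, and every vertical section of their union has at
  most four points.\<close>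

lemma double_hilbert_strip_AE:
  assumes e: "0 < e"
  shows "AE z in lborel. double_hilbert (indicator (strip e)) z =
    of_real (indicator (strip e) z + (if \<bar>snd z\<bar> < 1 then - 1 else 1) * cut_error e z / pi\<^sup>2)"
proof -
  have "AE z in (lborel \<Otimes>\<^sub>M lborel). \<bar>snd z\<bar> \<noteq> (1::real) \<and> \<bar>fst z - snd z\<bar> \<noteq> e"
  proof (rule lborel_pair.AE_pair_measure)
    show "{z \<in> space (lborel \<Otimes>\<^sub>M lborel). \<bar>snd z\<bar> \<noteq> (1::real) \<and> \<bar>fst z - snd z\<bar> \<noteq> e} \<in> sets (lborel \<Otimes>\<^sub>M lborel)"
      by measurable
    show "AE x in lborel. AE y in lborel. \<bar>snd (x, y)\<bar> \<noteq> (1::real) \<and> \<bar>fst (x, y) - snd (x, y)\<bar> \<noteq> e"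
    proof (rule AE_I2)
      fix x :: real
      show "AE y in lborel. \<bar>snd (x, y)\<bar> \<noteq> (1::real) \<and> \<bar>fst (x, y) - snd (x, y)\<bar> \<noteq> e"
        using AE_lborel_singleton[of "1::real"] AE_lborel_singleton[of "-1::real"]
          AE_lborel_singleton[of "x - e"] AE_lborel_singleton[of "x + e"]
        by eventually_elim auto
    qed
  qed
  then have "AE z in lborel. \<bar>snd z\<bar> \<noteq> (1::real) \<and> \<bar>fst z - snd z\<bar> \<noteq> e"
    by (simp only: lborel_prod)
  then show ?thesis
  proof eventually_elim
    case (elim z)
    then show ?case using double_hilbert_strip[OF e, of "snd z" "fst z"] by simp
  qed
qed

text \<open>The values of \<open>double_hilbert\<close> on the exceptional null set are not
  controlled; completeness of Lebesgue measure makes them irrelevant for measurability.\<close>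

lemma borel_measurable_AE_lborel:
  fixes f g :: "real \<times> real \<Rightarrow> complex"
  assumes "AE z in lborel. g z = f z" "f \<in> borel_measurable borel"
  shows "g \<in> borel_measurable lebesgue"
proof (rule borel_measurable_AE)
  show "f \<in> borel_measurable lebesgue"
    using assms(2) by (simp add: measurable_completion)
  show "AE z in lebesgue. f z = g z"
    using AE_completion[OF assms(1)] by eventually_elim simp
qed

text \<open>By \<open>(a + b)\<^sup>2 \<le> 2 * a\<^sup>2 + 2 * b\<^sup>2\<close> it suffices that
  the strip has finite area and the error a finite square integral.\<close>

lemma double_hilbert_strip_in_L2:
  assumes e: "0 < e"
  shows "double_hilbert (indicator (strip e)) \<in> L2_plane"
proof -
  let ?H = "double_hilbert (indicator (strip e))"
  let ?E = "\<lambda>z. (if \<bar>snd z\<bar> < 1 then - 1 else 1) * cut_error e z / pi\<^sup>2"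
  obtain C where C: "(\<integral>\<^sup>+ z. (ennreal \<bar>cut_error e z\<bar>)\<^sup>2 \<partial>lborel) \<le> ennreal (C * e powr (3/2))"
    using cut_error_L2_bound e by metis
  have [measurable]: "cut_error e \<in> borel_measurable (borel \<Otimes>\<^sub>M borel)" "strip e \<in> sets (borel \<Otimes>\<^sub>M borel)"
    using cut_error_measurable[of e] strip_measurable[of e] by (simp_all only: borel_prod)
  have "(\<lambda>z. complex_of_real (indicator (strip e) z + ?E z)) \<in> borel_measurable (borel \<Otimes>\<^sub>M borel)"
    by measurable
  then have "(\<lambda>z. complex_of_real (indicator (strip e) z + ?E z)) \<in> borel_measurable borel"
    by (simp only: borel_prod)
  then have meas [measurable]: "?H \<in> borel_measurable lebesgue"
    by (rule borel_measurable_AE_lborel[OF double_hilbert_strip_AE[OF e]])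
  have "integrable lebesgue (\<lambda>z. (cmod (?H z))\<^sup>2)"
  proof (rule integrableI_bounded)
    have "(\<integral>\<^sup>+ z. ennreal (norm ((cmod (?H z))\<^sup>2)) \<partial>lebesgue) = (\<integral>\<^sup>+ z. ennreal (norm ((cmod (?H z))\<^sup>2)) \<partial>lborel)"
      by (rule nn_integral_completion)
    also have "\<dots> \<le> (\<integral>\<^sup>+ z. 2 * indicator (strip e) z + 2 * (ennreal \<bar>cut_error e z\<bar>)\<^sup>2 \<partial>lborel)"
    proof (rule nn_integral_mono_AE)
      show "AE z in lborel. ennreal (norm ((cmod (?H z))\<^sup>2)) \<le> 2 * indicator (strip e) z + 2 * (ennreal \<bar>cut_error e z\<bar>)\<^sup>2"
        using double_hilbert_strip_AE[OF e]
      proof eventually_elim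
        case (elim z)
        define i :: real where "i = indicator (strip e) z"
        have "cmod (?H z) = \<bar>i + ?E z\<bar>"
          unfolding elim i_def by (rule norm_of_real)
        then have "norm ((cmod (?H z))\<^sup>2) = (i + ?E z)\<^sup>2" by simp
        also have "\<dots> \<le> 2 * i\<^sup>2 + 2 * (?E z)\<^sup>2"
          using zero_le_power2[of "i - ?E z"] unfolding power2_sum power2_diff by linarith
        also have "\<dots> \<le> 2 * i + 2 * \<bar>cut_error e z\<bar>\<^sup>2"
        proof -
          have "(?E z)\<^sup>2 = (cut_error e z)\<^sup>2 / (pi\<^sup>2)\<^sup>2"
            by (simp add: power_divide)
          also have "\<dots> \<le> (cut_error e z)\<^sup>2"
          proof -
            have "1 \<le> (pi\<^sup>2)\<^sup>2" using pi_gt3 by (intro one_le_power) simp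
            then show ?thesis by (simp add: divide_le_eq mult_le_cancel_left1)
          qed
          finally have "(?E z)\<^sup>2 \<le> \<bar>cut_error e z\<bar>\<^sup>2" by (simp only: power2_abs)
          moreover have "i\<^sup>2 = i" by (simp add: i_def indicator_def)
          ultimately show ?thesis by linarith
        qed
        finally have "ennreal (norm ((cmod (?H z))\<^sup>2)) \<le> ennreal (2 * i + 2 * \<bar>cut_error e z\<bar>\<^sup>2)"
          by (rule ennreal_leI)
        then show ?case
          by (simp add: i_def ennreal_mult ennreal_power ennreal_indicator)
      qed
    qed
    also have "\<dots> = 2 * (\<integral>\<^sup>+ z. indicator (strip e) z \<partial>lborel) + 2 * (\<integral>\<^sup>+ z. (ennreal \<bar>cut_error e z\<bar>)\<^sup>2 \<partial>lborel)"
      by (subst nn_integral_add, measurable, subst (1 2) nn_integral_cmult) auto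
    also have "\<dots> \<le> 2 * ennreal (4 * e) + 2 * ennreal (C * e powr (3/2))"
      using C e by (intro add_mono mult_left_mono) (auto simp: emeasure_strip)
    also have "\<dots> < \<infinity>"
      by (simp add: ennreal_mult_less_top)
    finally show "(\<integral>\<^sup>+ z. ennreal (norm ((cmod (?H z))\<^sup>2)) \<partial>lebesgue) < \<infinity>" .
  qed measurable
  with meas show ?thesis by (simp add: L2_plane_def)
qed

text \<open>The difference is the error up to sign and the factor \<open>1 / pi\<^sup>2\<close>,
  which is at most \<open>1\<close>.\<close>

lemma L2_norm_plane_strip_error_le:
  assumes e: "0 < e" and C: "0 \<le> C"
    "(\<integral>\<^sup>+ z. (ennreal \<bar>cut_error e z\<bar>)\<^sup>2 \<partial>lborel) \<le> ennreal (C * e powr (3/2))"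
  shows "L2_norm_plane (\<lambda>z. double_hilbert (indicator (strip e)) z - indicator (strip e) z) \<le> sqrt (C * e powr (3/2))"
proof -
  let ?D = "\<lambda>z. double_hilbert (indicator (strip e)) z - indicator (strip e) z"
  have "(LINT z|lebesgue. (cmod (?D z))\<^sup>2) \<le> enn2real (\<integral>\<^sup>+ z. ennreal ((cmod (?D z))\<^sup>2) \<partial>lebesgue)"
  \<comment> \<open>Only an upper bound is claimed, so the default value \<open>0\<close> in the
    nonintegrable case does no harm.\<close>
  proof (cases "integrable lebesgue (\<lambda>z. (cmod (?D z))\<^sup>2)")
    case True
    then show ?thesis by (subst integral_eq_nn_integral) auto
  qed (simp add: not_integrable_integral_eq)
  also have "\<dots> \<le> C * e powr (3/2)"
  proof (rule enn2real_leI)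
    have "(\<integral>\<^sup>+ z. ennreal ((cmod (?D z))\<^sup>2) \<partial>lebesgue) = (\<integral>\<^sup>+ z. ennreal ((cmod (?D z))\<^sup>2) \<partial>lborel)"
      by (rule nn_integral_completion)
    also have "\<dots> \<le> (\<integral>\<^sup>+ z. (ennreal \<bar>cut_error e z\<bar>)\<^sup>2 \<partial>lborel)"
    proof (rule nn_integral_mono_AE)
      show "AE z in lborel. ennreal ((cmod (?D z))\<^sup>2) \<le> (ennreal \<bar>cut_error e z\<bar>)\<^sup>2"
        using double_hilbert_strip_AE[OF e]
      proof eventually_elim
        case (elim z)
        have "?D z = of_real ((if \<bar>snd z\<bar> < 1 then - 1 else 1) * cut_error e z / pi\<^sup>2)"
          unfolding elim by (simp add: indicator_def)
        then have "cmod (?D z) = \<bar>(if \<bar>snd z\<bar> < 1 then - 1 else 1) * cut_error e z / pi\<^sup>2\<bar>"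
          by (simp only: norm_of_real)
        also have "\<dots> = \<bar>cut_error e z\<bar> / pi\<^sup>2"
          by (simp add: abs_mult)
        also have "\<dots> \<le> \<bar>cut_error e z\<bar>"
        proof -
          have "1 \<le> pi\<^sup>2" using pi_gt3 by (intro one_le_power) simp
          then show ?thesis by (simp add: divide_le_eq mult_le_cancel_left1)
        qed
        finally have "(cmod (?D z))\<^sup>2 \<le> \<bar>cut_error e z\<bar>\<^sup>2"
          by (rule power_mono) simp
        then show ?case by (simp add: ennreal_power ennreal_leI del: power2_abs)
      qed
    qed
    also note C(2)
    finally show "(\<integral>\<^sup>+ z. ennreal ((cmod (?D z))\<^sup>2) \<partial>lebesgue) \<le> ennreal (C * e powr (3/2))" .
  qed (use C in simp)
  finally show ?thesis by (simp add: L2_norm_plane_def)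
qed

theorem theorem1:
  shows "\<exists>V :: real \<Rightarrow> (real \<times> real) set.
    (\<forall>\<epsilon>>0. open (V \<epsilon>) \<and> bounded (V \<epsilon>) \<and> V \<epsilon> \<noteq> {} \<and>
       double_hilbert (indicator (V \<epsilon>)) \<in> L2_plane) \<and>
    ((\<lambda>\<epsilon>. L2_norm_plane (\<lambda>z. double_hilbert (indicator (V \<epsilon>)) z - indicator (V \<epsilon>) z)
          / L2_norm_plane (indicator (V \<epsilon>))) \<longlongrightarrow> 0) (at_right 0)"
proof (intro exI[of _ strip] conjI allI impI)
  fix e :: real assume e: "0 < e"
  show "open (strip e)" by (rule open_strip)
  show "bounded (strip e)" by (rule bounded_strip)
  have "(0, 0) \<in> strip e" using e by (simp add: strip_def)
  then show "strip e \<noteq> {}" by blast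
  show "double_hilbert (indicator (strip e)) \<in> L2_plane" by (rule double_hilbert_strip_in_L2[OF e])
next
  let ?q = "\<lambda>e. L2_norm_plane (\<lambda>z. double_hilbert (indicator (strip e)) z - indicator (strip e) z)
      / L2_norm_plane (indicator (strip e))"
  obtain C where C: "0 \<le> C" "\<And>e. 0 < e \<Longrightarrow>
      (\<integral>\<^sup>+ z. (ennreal \<bar>cut_error e z\<bar>)\<^sup>2 \<partial>lborel) \<le> ennreal (C * e powr (3/2))"
    using cut_error_L2_bound by metis
  have pos: "\<forall>\<^sub>F e in at_right (0::real). 0 < e"
    by (rule eventually_at_right_less)
  \<comment> \<open>The squared quotient is at most \<open>C * e powr (3/2)\<close> over the area
    \<open>4 * e\<close>, which leaves the positive power \<open>1/2\<close> of
    \<open>e\<close>.\<close>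
  have upper: "\<forall>\<^sub>F e in at_right 0. ?q e \<le> sqrt (C / 4 * e powr (1/2))"
    using pos
  proof eventually_elim
    case (elim e)
    have "?q e \<le> sqrt (C * e powr (3/2)) / sqrt (4 * e)"
      unfolding L2_norm_plane_strip[OF elim]
      by (intro divide_right_mono L2_norm_plane_strip_error_le C elim) (use elim in simp)
    also have "\<dots> = sqrt (C / 4 * e powr (1/2))"
    proof -
      have "e powr (1 + 1/2) = e powr 1 * e powr (1/2)" by (rule powr_add)
      then have "C * e powr (3/2) / (4 * e) = C / 4 * e powr (1/2)"
        using elim by simp
      then show ?thesis by (simp flip: real_sqrt_divide)
    qed
    finally show ?case .
  qed
  have lower: "\<forall>\<^sub>F e in at_right 0. 0 \<le> ?q e"
    by (intro always_eventually allI divide_nonneg_nonneg) (auto simp: L2_norm_plane_def)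
  have "((\<lambda>e. sqrt (C / 4 * e powr (1/2))) \<longlongrightarrow> sqrt (C / 4 * 0 powr (1/2))) (at_right 0)"
    by (intro tendsto_intros tendsto_powr') (auto intro: eventually_mono[OF pos])
  then have "((\<lambda>e. sqrt (C / 4 * e powr (1/2))) \<longlongrightarrow> 0) (at_right 0)" by simp
  with lower upper show "(?q \<longlongrightarrow> 0) (at_right 0)"
    by (rule tendsto_sandwich[OF _ _ tendsto_const])
qed

end
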